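(* There exists a positive constant $C$ (depending only on the dimension $n$) such that for every $b\in\operatorname{BMO}(\mathbb{R}^n)$ with $b^-\in L_\infty(\mathbb{R}^n)$, every $f\in L(1+\log^+L)$ and every $\lambda>0$, $$|\{x\in\mathbb{R}^n:|[M,b]f(x)|>\lambda\}|\le C\,C_0\left(1+\log^+C_0\right)\int_{\mathbb{R}^n}\frac{|f(x)|}{\lambda}\left(1+\log^+\left(\frac{|f(x)|}{\lambda}\right)\right)dx,$$ where $C_0=\|b^+\|_*+\|b^-\|_\infty$.
   Context: Cubes in $\mathbb{R}^n$ have sides parallel to the coordinate axes. The Hardy–Littlewood maximal operator is $Mf(x)=\sup_{Q\ni x}\frac1{|Q|}\int_Q|f(y)|\,dy$, the supremum being over all cubes $Q$ containing $x$. For $b\in L_1^{\mathrm{loc}}(\mathbb{R}^n)$, $\|b\|_*=\sup_Q\frac1{|Q|}\int_Q|b(y)-b_Q|\,dy$ with $b_Q=\frac1{|Q|}\int_Q b$, and $b\in\operatorname{BMO}(\mathbb{R}^n)$ means $\|b\|_*<\infty$. $b^+=\max\{b,0\}$, $b^-=-\min\{b,0\}$, and $\|\cdot\|_\infty$ is the $L_\infty(\mathbb{R}^n)$ norm. The commutator of $M$ and $b$ is $[M,b]f(x)=M(bf)(x)-b(x)Mf(x)$ (defined for almost every $x$ for the $f$ considered). $L(1+\log^+L)$ is the set of measurable $f$ on $\mathbb{R}^n$ with $\int_{\mathbb{R}^n}|f(x)|(1+\log^+|f(x)|)\,dx<\infty$, where $\log^+t=\max\{\log t,0\}$ (and $\log^+0=0$).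 *)

theory Defs
  imports "HOL-Analysis.Analysis" "HOL-Probability.Essential_Supremum"
begin

definition cubes :: "(real ^ 'n) set set" where
  "cubes = {Q. \<exists>a r. r > 0 \<and> Q = cbox a (\<chi> i. a $ i + r)}"

text \<open>Uncentred Hardy--Littlewood maximal function; the value \<open>\<infinity>\<close> is allowed.\<close>

definition hl_maximal :: "(real ^ 'n \<Rightarrow> real) \<Rightarrow> real ^ 'n \<Rightarrow> ennreal" where
  "hl_maximal f x =
     (SUP Q \<in> {Q \<in> cubes. x \<in> Q}.
        (\<integral>\<^sup>+y\<in>Q. ennreal \<bar>f y\<bar> \<partial>lebesgue) / emeasure lebesgue Q)"

text \<open>The subtraction is done in \<open>ereal\<close>, so that no value is made up where one of the two maximal
  functions is infinite. In particular \<open>\<infinity> - \<infinity> = \<infinity>\<close> there, so that a point of indeterminacy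
  belongs to every superlevel set of the absolute value of the commutator.\<close>

definition hl_commutator ::
    "(real ^ 'n \<Rightarrow> real) \<Rightarrow> (real ^ 'n \<Rightarrow> real) \<Rightarrow> real ^ 'n \<Rightarrow> ereal" where
  "hl_commutator b f x =
     enn2ereal (hl_maximal (\<lambda>y. b y * f y) x) - ereal (b x) * enn2ereal (hl_maximal f x)"

definition locally_integrable :: "(real ^ 'n \<Rightarrow> real) \<Rightarrow> bool" where
  "locally_integrable b \<longleftrightarrow> (\<forall>K. compact K \<longrightarrow> set_integrable lebesgue K b)"

definition average :: "(real ^ 'n \<Rightarrow> real) \<Rightarrow> (real ^ 'n) set \<Rightarrow> real" where
  "average b Q = (LINT y:Q|lebesgue. b y) / measure lebesgue Q"

definition bmo_norm :: "(real ^ 'n \<Rightarrow> real) \<Rightarrow> ennreal" where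
  "bmo_norm b =
     (SUP Q \<in> cubes.
        (\<integral>\<^sup>+y\<in>Q. ennreal \<bar>b y - average b Q\<bar> \<partial>lebesgue) / emeasure lebesgue Q)"

definition BMO :: "(real ^ 'n \<Rightarrow> real) set" where
  "BMO = {b. locally_integrable b \<and> bmo_norm b < \<infinity>}"

definition Linf_norm :: "(real ^ 'n \<Rightarrow> real) \<Rightarrow> ennreal" where
  "Linf_norm g = esssup lebesgue (\<lambda>x. ennreal \<bar>g x\<bar>)"

definition Linf :: "(real ^ 'n \<Rightarrow> real) set" where
  "Linf = {g. g \<in> borel_measurable lebesgue \<and> Linf_norm g < \<infinity>}"

definition pos_part :: "(real ^ 'n \<Rightarrow> real) \<Rightarrow> real ^ 'n \<Rightarrow> real" where
  "pos_part b x = max (b x) 0"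

definition neg_part :: "(real ^ 'n \<Rightarrow> real) \<Rightarrow> real ^ 'n \<Rightarrow> real" where
  "neg_part b x = - min (b x) 0"

text \<open>The convention \<open>log\<^sup>+ 0 = 0\<close> is met because \<open>ln 0 = 0\<close> for reals.\<close>

definition log_plus :: "ennreal \<Rightarrow> ennreal" where
  "log_plus t = (if t = \<infinity> then \<infinity> else ennreal (max (ln (enn2real t)) 0))"

lemma log_plus_ennreal: "t \<ge> 0 \<Longrightarrow> log_plus (ennreal t) = ennreal (max (ln t) 0)"
  by (simp add: log_plus_def)

definition LlogL_integral :: "(real ^ 'n \<Rightarrow> real) \<Rightarrow> ennreal" where
  "LlogL_integral f =
     (\<integral>\<^sup>+x. ennreal \<bar>f x\<bar> * (1 + log_plus (ennreal \<bar>f x\<bar>)) \<partial>lebesgue)"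

definition LlogL :: "(real ^ 'n \<Rightarrow> real) set" where
  "LlogL = {f. f \<in> borel_measurable lebesgue \<and> LlogL_integral f < \<infinity>}"

end

(* Let p = b^+ and let beta bound both the BMO norm of p and b^- almost everywhere. Since |b| differs from b by
   at most 2 beta almost everywhere, |[M,b]f(x)| is at most 3 beta Mf(x) plus the supremum over cubes Q containing x of
   the averages of |p(x) - p| |f|. With p_Q the average of p, this supremum is split into
   |p(x) - p_Q| <|f|>_Q and <|p - p_Q| |f|>_Q. The first term even has a weak (1,1) bound: one sums over the
   dyadic sizes of <|f|>_Q, using a Vitali covering at each size and the second moment of the oscillation of p.
   The second term is reduced by Young's inequality u t <= e^u - 1 + t log^+ t and the John-Nirenberg
   inequality to the maximal function of t log^+ t with t = C beta |f| / lambda. Outer measures are used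
   throughout because the level sets need not be measurable a priori. *)

theory Submission
  imports Defs
begin

text \<open>Once the size of <|f|>_Q is fixed, all admissible Q lie in countably many fixed cubes of
  controlled total volume; inside one of these the moving average p_Q is compared with a fixed one
  at the cost of a maximal function. First moments would not be enough: both the total volume and
  the required oscillation grow like 2 ^ k, and the sum would diverge. In the second term the -1 in
  e^u - 1 matters: John-Nirenberg is normalised so that the mean of e^u - 1 is at most 1/2, and this
  part is absorbed into |Q|. The factor C0 (1 + log^+ C0) comes from the submultiplicativity of t (1
  + log^+ t), which separates \<beta> from |f| / \<lambda>. Since \<beta> is divided by, all
  estimates are stated for a positive \<beta> dominating C0; the choice is \<beta> = C0 if 0 < C0 <
  \<infinity>, and \<beta> tends to 0 if C0 = 0.\<close>

declare emeasure_completion [simp del]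

section \<open>Outer measure\<close>

text \<open>Tonelli applied to the indicators. The sum is an integral over
  \<open>count_space\<close> because the Vitali families are indexed by countable sets of pairs
  (corner, side) rather than by numbers.\<close>

lemma emeasure_UN_le_count_space:
  assumes I: "countable I" and X: "\<And>i. i \<in> I \<Longrightarrow> X i \<in> sets M"
  shows "emeasure M (\<Union>i\<in>I. X i) \<le> (\<integral>\<^sup>+i. emeasure M (X i) \<partial>count_space I)"
proof -
  have "emeasure M (\<Union>i\<in>I. X i) = (\<integral>\<^sup>+x. indicator (\<Union>i\<in>I. X i) x \<partial>M)"
    using sets.countable_UN''[OF I X] by (simp add: nn_integral_indicator)
  also have "\<dots> \<le> (\<integral>\<^sup>+x. \<integral>\<^sup>+i. indicator (X i) x \<partial>count_space I \<partial>M)"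
  proof (intro nn_integral_mono)
    fix x
    show "indicator (\<Union>i\<in>I. X i) x \<le> (\<integral>\<^sup>+i. indicator (X i) x \<partial>count_space I :: ennreal)"
    proof (cases "x \<in> (\<Union>i\<in>I. X i)")
      case True
      then obtain i where i: "i \<in> I" "x \<in> X i" by auto
      have "(\<integral>\<^sup>+j. indicator {i} j \<partial>count_space I) \<le> (\<integral>\<^sup>+j. (indicator (X j) x :: ennreal) \<partial>count_space I)"
        using i by (intro nn_integral_mono) (auto simp: indicator_def)
      moreover have "(\<integral>\<^sup>+j. (indicator {i} j :: ennreal) \<partial>count_space I) = 1"
        using i by (subst nn_integral_indicator) auto
      ultimately show ?thesis using i by (auto simp: indicator_def)
    qed simp
  qed
  also have "\<dots> = (\<integral>\<^sup>+i. \<integral>\<^sup>+x. indicator (X i) x \<partial>M \<partial>count_space I)"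
    using X by (intro nn_integral_count_space_nn_integral[OF I]) auto
  also have "\<dots> = (\<integral>\<^sup>+i. emeasure M (X i) \<partial>count_space I)"
    using X by (intro nn_integral_cong) (auto simp: nn_integral_indicator)
  finally show ?thesis .
qed

text \<open>Each set is replaced by a measurable hull of equal outer measure, which reduces the
  claim to measurable sets.\<close>

lemma outer_measure_of_UN_le:
  assumes I: "countable I" and A: "\<And>i. i \<in> I \<Longrightarrow> A i \<subseteq> space M"
  shows "outer_measure_of M (\<Union>i\<in>I. A i) \<le> (\<integral>\<^sup>+i. outer_measure_of M (A i) \<partial>count_space I)"
proof -
  have "\<forall>i\<in>I. \<exists>E\<in>sets M. A i \<subseteq> E \<and> outer_measure_of M (A i) = emeasure M E"
    using outer_measure_of_attain[OF A] by blast
  then obtain E where E: "\<And>i. i \<in> I \<Longrightarrow> E i \<in> sets M" "\<And>i. i \<in> I \<Longrightarrow> A i \<subseteq> E i"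
      "\<And>i. i \<in> I \<Longrightarrow> outer_measure_of M (A i) = emeasure M (E i)"
    by metis
  have "outer_measure_of M (\<Union>i\<in>I. A i) \<le> outer_measure_of M (\<Union>i\<in>I. E i)"
    using E by (intro outer_measure_of_mono) blast
  also have "\<dots> = emeasure M (\<Union>i\<in>I. E i)"
    using E I by (intro outer_measure_of_eq sets.countable_UN'') auto
  also have "\<dots> \<le> (\<integral>\<^sup>+i. emeasure M (E i) \<partial>count_space I)"
    by (rule emeasure_UN_le_count_space[OF I E(1)])
  also have "\<dots> = (\<integral>\<^sup>+i. outer_measure_of M (A i) \<partial>count_space I)"
    using E by (intro nn_integral_cong) auto
  finally show ?thesis .
qed

lemma outer_measure_of_Un_le:
  assumes "A \<subseteq> space M" "B \<subseteq> space M"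
  shows "outer_measure_of M (A \<union> B) \<le> outer_measure_of M A + outer_measure_of M B"
proof -
  have "outer_measure_of M (\<Union>i\<in>(UNIV::bool set). if i then A else B)
      \<le> (\<integral>\<^sup>+i. outer_measure_of M (if i then A else B) \<partial>count_space UNIV)"
    using assms by (intro outer_measure_of_UN_le) auto
  also have "(\<Union>i\<in>(UNIV::bool set). if i then A else B) = A \<union> B"
    by (auto split: if_splits)
  finally show ?thesis
    by (simp add: nn_integral_count_space_finite UNIV_bool add.commute)
qed

text \<open>Transfers the outer measure bounds to the \<open>emeasure\<close> in the theorem; on a
  non-measurable set \<open>emeasure\<close> is 0 by convention, so the inequality holds there as
  well.\<close>

lemma emeasure_le_outer_measure_of: "emeasure M A \<le> outer_measure_of M A"
  by (auto simp: outer_measure_of_def intro!: INF_greatest emeasure_mono)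

section \<open>Cubes and the covering lemma\<close>

definition cube :: "real ^ 'n \<Rightarrow> real \<Rightarrow> (real ^ 'n) set" where
  "cube a r = cbox a (\<chi> i. a $ i + r)"

text \<open>The cube circumscribed about the ball of radius 5 n r around the corner
  \<open>a\<close>: the l1 bound on the norm puts \<open>cube a r\<close> into the ball of radius n
  r about \<open>a\<close>, and 5 is Vitali's enlargement factor. The volume grows by (10 n) ^ n,
  which is \<open>dilation_ratio\<close>.\<close>

definition dilated_cube :: "real ^ 'n \<Rightarrow> real \<Rightarrow> (real ^ 'n) set" where
  "dilated_cube a r = cube (\<chi> i. a $ i - 5 * real CARD('n) * r) (10 * real CARD('n) * r)"

abbreviation dilation_ratio :: "'n itself \<Rightarrow> real" where
  "dilation_ratio _ \<equiv> (10 * real CARD('n)) ^ CARD('n)"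

lemma cubes_iff: "Q \<in> cubes \<longleftrightarrow> (\<exists>a r. r > 0 \<and> Q = cube a r)"
  by (auto simp: cubes_def cube_def)

lemma cube_in_cubes: "r > 0 \<Longrightarrow> cube a r \<in> cubes"
  by (auto simp: cubes_iff)

lemma mem_cube: "x \<in> cube a r \<longleftrightarrow> (\<forall>i. a $ i \<le> x $ i \<and> x $ i \<le> a $ i + r)"
  by (simp add: cube_def mem_box_cart)

lemma cube_mono:
  assumes "\<And>i. a' $ i \<le> a $ i" "\<And>i. a $ i + r \<le> a' $ i + r'"
  shows "cube a r \<subseteq> cube a' r'"
  using assms by (fastforce simp: mem_cube intro: order_trans)

text \<open>Brings cubes into the form in which the differentiation theorem
  \<open>integrable_ccontinuous_explicit\<close> is phrased.\<close>

lemma cube_eq_One: "cube a r = cbox a (a + r *\<^sub>R One)"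
proof -
  have "(One :: real ^ 'a) $ i = 1" for i
    using inner_sum_left_Basis[of "axis i 1 :: real ^ 'a" "\<lambda>_. 1"]
    by (simp add: cart_eq_inner_axis axis_in_Basis_iff del: sum_component)
  then show ?thesis
    unfolding cube_def by (intro arg_cong[of _ _ "cbox a"]) (simp add: vec_eq_iff)
qed

lemma sets_cube [measurable, simp]: "cube a r \<in> sets lebesgue"
  by (simp add: cube_def)

lemma compact_cube: "compact (cube a r)"
  by (simp add: cube_def compact_cbox)

lemma emeasure_cube:
  fixes a :: "real ^ 'n"
  assumes "r \<ge> 0"
  shows "emeasure lebesgue (cube a r) = ennreal (r ^ CARD('n))"
proof -
  have "emeasure lebesgue (cube a r) = emeasure lborel (cube a r)"
    by (simp add: cube_def emeasure_completion)
  also have "\<dots> = ennreal (measure lborel (cube a r))"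
    unfolding cube_def by (intro emeasure_eq_ennreal_measure) (simp add: emeasure_lborel_cbox_eq)
  also have "measure lborel (cube a r) = r ^ CARD('n)"
    using assms by (simp add: cube_def content_cbox_cart interval_ne_empty_cart)
  finally show ?thesis .
qed

lemma measure_cube:
  fixes a :: "real ^ 'n"
  shows "r \<ge> 0 \<Longrightarrow> measure lebesgue (cube a r) = r ^ CARD('n)"
  by (metis emeasure_cube measure_def enn2real_ennreal zero_le_power)

lemma cube_subset_cball:
  fixes a :: "real ^ 'n"
  shows "cube a r \<subseteq> cball a (real CARD('n) * r)"
proof
  fix x assume x: "x \<in> cube a r"
  have "dist a x = norm (a - x)" by (simp add: dist_norm)
  also have "\<dots> \<le> (\<Sum>i\<in>UNIV. \<bar>(a - x) $ i\<bar>)" by (rule norm_le_l1_cart)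
  also have "\<dots> \<le> (\<Sum>i\<in>(UNIV::'n set). r)"
    using x by (intro sum_mono) (auto simp: mem_cube abs_le_iff algebra_simps)
  finally show "x \<in> cball a (real CARD('n) * r)" by simp
qed

lemma cball_subset_dilated_cube:
  fixes a :: "real ^ 'n"
  shows "cball a (5 * (real CARD('n) * r)) \<subseteq> dilated_cube a r"
proof
  fix x assume x: "x \<in> cball a (5 * (real CARD('n) * r))"
  have "\<bar>(x - a) $ i\<bar> \<le> 5 * (real CARD('n) * r)" for i
    using component_le_norm_cart[of "x - a" i] x by (auto simp: dist_norm norm_minus_commute)
  then have "\<bar>x $ i - a $ i\<bar> \<le> 5 * (real CARD('n) * r)" for i by simp
  then show "x \<in> dilated_cube a r"
    unfolding dilated_cube_def by (auto simp: mem_cube abs_le_iff algebra_simps)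
qed

lemma cube_subset_dilated_cube:
  fixes a :: "real ^ 'n"
  assumes "r \<ge> 0"
  shows "cube a r \<subseteq> dilated_cube a r"
proof -
  have "cube a r \<subseteq> cball a (real CARD('n) * r)" by (rule cube_subset_cball)
  also have "\<dots> \<subseteq> cball a (5 * (real CARD('n) * r))"
    using assms by (intro subset_cball) (simp add: mult_nonneg_nonneg)
  also have "\<dots> \<subseteq> dilated_cube a r" by (rule cball_subset_dilated_cube)
  finally show ?thesis .
qed

lemma emeasure_dilated_cube:
  fixes a :: "real ^ 'n"
  assumes "r \<ge> 0"
  shows "emeasure lebesgue (dilated_cube a r) = ennreal (dilation_ratio TYPE('n)) * ennreal (r ^ CARD('n))"
  unfolding dilated_cube_def using assms
  by (subst emeasure_cube) (auto simp: power_mult_distrib ennreal_mult')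

lemma dilation_ratio_ge_1: "dilation_ratio TYPE('n::finite) \<ge> 1"
proof -
  have "real CARD('n) \<ge> 1"
    using Suc_leI[OF zero_less_card_finite[where 'a='n]] by linarith
  then show ?thesis by (intro one_le_power) linarith
qed

text \<open>The lower bound on the mean of \<open>g\<close> bounds the sides in \<open>F\<close>, so
  Vitali's lemma applies to balls around the cubes; the selected cubes are disjoint, so their
  integrals of \<open>g\<close> sum to at most the whole integral. The sum of volumes is recorded,
  not the measure of a union, because later each dilated cube carries its own estimate.\<close>

lemma cube_covering:
  fixes g :: "real ^ 'n \<Rightarrow> ennreal" and F :: "((real ^ 'n) \<times> real) set"
  assumes g [measurable]: "g \<in> borel_measurable lebesgue" and s: "s > 0"
    and fin: "(\<integral>\<^sup>+x. g x \<partial>lebesgue) < \<infinity>"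
    and F: "\<And>a r. (a, r) \<in> F \<Longrightarrow> r > 0 \<and> ennreal s * ennreal (r ^ CARD('n)) \<le> (\<integral>\<^sup>+y\<in>cube a r. g y \<partial>lebesgue)"
  obtains C where "countable C" "C \<subseteq> F"
    "\<And>a r. (a, r) \<in> F \<Longrightarrow> \<exists>(a', r')\<in>C. cube a r \<subseteq> dilated_cube a' r'"
    "ennreal s * (\<integral>\<^sup>+q. ennreal (snd q ^ CARD('n)) \<partial>count_space C) \<le> (\<integral>\<^sup>+x. g x \<partial>lebesgue)"
proof -
  let ?n = "real CARD('n)"
  define G where "G = enn2real (\<integral>\<^sup>+x. g x \<partial>lebesgue)"
  have G: "(\<integral>\<^sup>+x. g x \<partial>lebesgue) = ennreal G" "G \<ge> 0"
    using fin by (auto simp: G_def)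
  have sub: "(\<integral>\<^sup>+y\<in>A. g y \<partial>lebesgue) \<le> ennreal G" for A
    unfolding G(1)[symmetric] by (intro nn_integral_mono) (auto simp: indicator_def)
  have bound: "0 < ?n * snd q \<and> ?n * snd q \<le> ?n * (1 + G / s)" if q: "q \<in> F" for q
  proof -
    obtain a r where qq: "q = (a, r)" by force
    have r: "r > 0" using F q qq by auto
    have "ennreal (s * r ^ CARD('n)) \<le> ennreal G"
      using F[of a r] q qq sub[of "cube a r"] s r by (auto simp: ennreal_mult' intro: order_trans)
    then have *: "r ^ CARD('n) \<le> G / s"
      using G s by (simp add: field_simps ennreal_le_iff)
    \<comment> \<open>Vitali's lemma asks for some uniform bound on the radii; this one avoids the
      n-th root of G / s.\<close>
    have "r \<le> 1 + G / s"
    proof (cases "r \<le> 1")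
      case True
      then show ?thesis using G s by (simp add: add_increasing2)
    next
      case False
      then have "r \<le> r ^ CARD('n)" by (intro self_le_power) auto
      with * show ?thesis by linarith
    qed
    then show ?thesis using r qq by simp
  qed
  obtain C where C: "countable C" "C \<subseteq> F"
     "pairwise (\<lambda>i j. disjnt (cball (fst i) (?n * snd i)) (cball (fst j) (?n * snd j))) C"
     "\<And>i. i \<in> F \<Longrightarrow> \<exists>j. j \<in> C \<and>
           \<not> disjnt (cball (fst i) (?n * snd i)) (cball (fst j) (?n * snd j)) \<and>
           cball (fst i) (?n * snd i) \<subseteq> ball (fst j) (5 * (?n * snd j))"
    by (rule Vitali_covering_lemma_cballs_balls[of F "\<lambda>q. ?n * snd q" "?n * (1 + G / s)" fst, OF bound])
      blast+
  have Cr: "snd q > 0" if "q \<in> C" for q using F[of "fst q" "snd q"] that C(2) by auto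
  have cov: "\<exists>(a', r')\<in>C. cube a r \<subseteq> dilated_cube a' r'" if F: "(a, r) \<in> F" for a r
  proof -
    obtain j where j: "j \<in> C" "cball a (?n * r) \<subseteq> ball (fst j) (5 * (?n * snd j))"
      using C(4)[OF F] by auto
    have "cube a r \<subseteq> dilated_cube (fst j) (snd j)"
      using cube_subset_cball[of a r] j(2) ball_subset_cball cball_subset_dilated_cube by blast
    with j(1) show ?thesis by force
  qed
  \<comment> \<open>The selected balls are disjoint and contain their cubes, so a point lies in at
    most one selected cube.\<close>
  have disj: "x \<in> cube (fst p) (snd p) \<Longrightarrow> x \<in> cube (fst q) (snd q) \<Longrightarrow> p \<in> C \<Longrightarrow> q \<in> C \<Longrightarrow> p = q" for x p q
    using pairwiseD[OF C(3), of p q] cube_subset_cball[of "fst p" "snd p"] cube_subset_cball[of "fst q" "snd q"]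
    unfolding disjnt_def by blast
  have "ennreal s * (\<integral>\<^sup>+q. ennreal (snd q ^ CARD('n)) \<partial>count_space C)
     = (\<integral>\<^sup>+q. ennreal s * ennreal (snd q ^ CARD('n)) \<partial>count_space C)"
    by (simp add: nn_integral_cmult)
  also have "\<dots> \<le> (\<integral>\<^sup>+q. (\<integral>\<^sup>+y\<in>cube (fst q) (snd q). g y \<partial>lebesgue) \<partial>count_space C)"
    using C(2) F by (intro nn_integral_mono) (auto simp: subset_iff)
  also have "\<dots> = (\<integral>\<^sup>+y. \<integral>\<^sup>+q. g y * indicator (cube (fst q) (snd q)) y \<partial>count_space C \<partial>lebesgue)"
    by (intro nn_integral_count_space_nn_integral[symmetric] C) measurable
  also have "\<dots> \<le> (\<integral>\<^sup>+y. g y \<partial>lebesgue)"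
  proof (intro nn_integral_mono)
    fix y
    show "(\<integral>\<^sup>+q. g y * indicator (cube (fst q) (snd q)) y \<partial>count_space C) \<le> g y"
    proof (cases "\<exists>q\<in>C. y \<in> cube (fst q) (snd q)")
      case True
      then obtain q where q: "q \<in> C" "y \<in> cube (fst q) (snd q)" by auto
      have "(\<integral>\<^sup>+p. g y * indicator (cube (fst p) (snd p)) y \<partial>count_space C) = (\<integral>\<^sup>+p. g y * indicator {q} p \<partial>count_space C)"
      proof (intro nn_integral_cong)
        fix p assume "p \<in> space (count_space C)"
        then have "y \<in> cube (fst p) (snd p) \<longleftrightarrow> p \<in> {q}"
          using disj[OF _ q(2) _ q(1), of p] q(2) by (metis singleton_iff space_count_space)
        then show "g y * indicator (cube (fst p) (snd p)) y = g y * indicator {q} p"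
          unfolding indicator_def by presburger
      qed
      also have "\<dots> = g y"
        using q(1) by (subst nn_integral_cmult) (auto simp: nn_integral_indicator)
      finally show ?thesis by simp
    next
      case False
      then have "(\<integral>\<^sup>+p. g y * indicator (cube (fst p) (snd p)) y \<partial>count_space C) = (\<integral>\<^sup>+p. 0 \<partial>count_space C)"
        by (intro nn_integral_cong) (auto simp: indicator_def)
      then show ?thesis by simp
    qed
  qed
  finally show ?thesis using that C(1,2) cov by blast
qed

text \<open>Every cube competing in the level set lies in a dilated selected cube, and the selected
  volumes sum to at most the integral divided by \<open>s\<close>. The condition on the mean is
  multiplied out to avoid division in \<open>ennreal\<close>.\<close>

lemma maximal_weak_type:
  fixes g :: "real ^ 'n \<Rightarrow> ennreal"
  assumes g [measurable]: "g \<in> borel_measurable lebesgue" and s: "s > 0"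
  shows "ennreal s * outer_measure_of lebesgue
           {x. \<exists>Q\<in>cubes. x \<in> Q \<and> ennreal s * emeasure lebesgue Q \<le> (\<integral>\<^sup>+y\<in>Q. g y \<partial>lebesgue)}
         \<le> ennreal (dilation_ratio TYPE('n)) * (\<integral>\<^sup>+x. g x \<partial>lebesgue)"
    (is "_ * outer_measure_of _ ?S \<le> ennreal ?D * ?I")
proof (cases "?I = \<infinity>")
  case True
  have "?D > 0" using dilation_ratio_ge_1[where 'n='n] by linarith
  then show ?thesis using True by (simp add: ennreal_mult_top)
next
  case False
  define F where "F = {(a, r). r > 0 \<and> ennreal s * ennreal (r ^ CARD('n)) \<le> (\<integral>\<^sup>+y\<in>cube a r. g y \<partial>lebesgue)}"
  obtain C where C: "countable C" "C \<subseteq> F"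
    "\<And>a r. (a, r) \<in> F \<Longrightarrow> \<exists>(a', r')\<in>C. cube a r \<subseteq> dilated_cube a' r'"
    "ennreal s * (\<integral>\<^sup>+q. ennreal (snd q ^ CARD('n)) \<partial>count_space C) \<le> ?I"
    using cube_covering[of g s F] g s False by (auto simp: F_def less_top)
  have Cr: "snd q \<ge> 0" if "q \<in> C" for q using that C(2) by (auto simp: F_def)
  have "?S \<subseteq> (\<Union>q\<in>C. dilated_cube (fst q) (snd q))"
  proof
    fix x assume "x \<in> ?S"
    then obtain Q where "Q \<in> cubes" "x \<in> Q" "ennreal s * emeasure lebesgue Q \<le> (\<integral>\<^sup>+y\<in>Q. g y \<partial>lebesgue)" by blast
    then obtain a r where "r > 0" "Q = cube a r" by (auto simp: cubes_iff)
    with \<open>x \<in> Q\<close> \<open>_ \<le> set_nn_integral lebesgue Q g\<close> have ar: "(a, r) \<in> F" "x \<in> cube a r"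
      using emeasure_cube[of r a] by (auto simp: F_def simp del: emeasure_completion)
    then show "x \<in> (\<Union>q\<in>C. dilated_cube (fst q) (snd q))"
      using C(3)[OF ar(1)] by fastforce
  qed
  then have "outer_measure_of lebesgue ?S \<le> outer_measure_of lebesgue (\<Union>q\<in>C. dilated_cube (fst q) (snd q))"
    by (rule outer_measure_of_mono)
  also have "\<dots> \<le> (\<integral>\<^sup>+q. outer_measure_of lebesgue (dilated_cube (fst q) (snd q)) \<partial>count_space C)"
    by (intro outer_measure_of_UN_le C) auto
  also have "\<dots> = (\<integral>\<^sup>+q. ennreal ?D * ennreal (snd q ^ CARD('n)) \<partial>count_space C)"
    using Cr by (intro nn_integral_cong) (simp add: dilated_cube_def emeasure_dilated_cube[unfolded dilated_cube_def])
  also have "\<dots> = ennreal ?D * (\<integral>\<^sup>+q. ennreal (snd q ^ CARD('n)) \<partial>count_space C)"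
    by (simp add: nn_integral_cmult)
  finally have "ennreal s * outer_measure_of lebesgue ?S \<le> ennreal ?D * (ennreal s * (\<integral>\<^sup>+q. ennreal (snd q ^ CARD('n)) \<partial>count_space C))"
    by (simp add: mult_left_mono mult.left_commute)
  also have "\<dots> \<le> ennreal ?D * ?I" by (intro mult_left_mono C) simp
  finally show ?thesis .
qed

section \<open>The John--Nirenberg inequality\<close>

text \<open>Here \<beta> is any positive upper bound of the BMO norm: positivity permits division by
  it, and the slack lets the same \<beta> dominate b^- later.\<close>

definition bmo_bounded :: "(real ^ 'n \<Rightarrow> real) \<Rightarrow> real \<Rightarrow> bool" where
  "bmo_bounded p \<beta> \<longleftrightarrow> locally_integrable p \<and> \<beta> > 0 \<and>
     (\<forall>Q\<in>cubes. (\<integral>\<^sup>+y\<in>Q. ennreal \<bar>p y - average p Q\<bar> \<partial>lebesgue) \<le> ennreal \<beta> * emeasure lebesgue Q)"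

section \<open>Local integrability, averages and differentiation along cubes\<close>

lemma locally_integrable_cube:
  "locally_integrable p \<Longrightarrow> set_integrable lebesgue (cube a r) p"
  by (simp add: locally_integrable_def compact_cube)

text \<open>\<open>p\<close> is the pointwise limit of its restrictions to the balls of radius k,
  which are integrable.\<close>

lemma locally_integrable_measurable:
  fixes p :: "real ^ 'n \<Rightarrow> real"
  assumes "locally_integrable p"
  shows "p \<in> borel_measurable lebesgue"
proof (rule borel_measurable_LIMSEQ_real)
  let ?B = "\<lambda>k. cball (0 :: real ^ 'n) (real k)"
  show "(\<lambda>x. indicat_real (?B k) x * p x) \<in> borel_measurable lebesgue" for k
    using assms unfolding locally_integrable_def set_integrable_def
    by (auto dest!: spec[of _ "?B k"] borel_measurable_integrable)
  show "(\<lambda>k. indicat_real (?B k) x * p x) \<longlonglongrightarrow> p x" for x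
  proof (rule tendsto_eventually)
    have "\<forall>\<^sub>F k in sequentially. norm x \<le> real k"
      using eventually_ge_at_top[of "nat \<lceil>norm x\<rceil>"] by eventually_elim linarith
    then show "\<forall>\<^sub>F k in sequentially. indicat_real (?B k) x * p x = p x"
      by eventually_elim simp
  qed
qed

lemma set_integrable_const_compact:
  fixes K :: "'a :: euclidean_space set"
  shows "compact K \<Longrightarrow> set_integrable lebesgue K (\<lambda>_. c :: real)"
  using lmeasurable_compact[of K]
  by (auto simp: set_integrable_def fmeasurable_def less_top intro!: integrable_mult_left integrable_real_indicator)

lemma locally_integrable_diff_const:
  "locally_integrable p \<Longrightarrow> locally_integrable (\<lambda>x. p x - c)"
  unfolding locally_integrable_def
  by (auto intro!: set_integral_diff(1) set_integrable_const_compact)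

lemma locally_integrable_abs:
  "locally_integrable p \<Longrightarrow> locally_integrable (\<lambda>x. \<bar>p x\<bar>)"
  using set_integrable_abs by (fastforce simp: locally_integrable_def)

lemma set_nn_integral_eq_set_integral:
  fixes p :: "'a \<Rightarrow> real"
  assumes int: "set_integrable M A p" and nonneg: "\<And>x. p x \<ge> 0"
  shows "(\<integral>\<^sup>+y\<in>A. ennreal (p y) \<partial>M) = ennreal (LINT y:A|M. p y)"
proof -
  have "(\<integral>\<^sup>+y\<in>A. ennreal (p y) \<partial>M) = (\<integral>\<^sup>+y. ennreal (indicator A y *\<^sub>R p y) \<partial>M)"
    by (intro nn_integral_cong) (auto simp: indicator_def)
  also have "\<dots> = ennreal (LINT y:A|M. p y)"
    unfolding set_lebesgue_integral_def
    using int nonneg by (intro nn_integral_eq_integral) (auto simp: set_integrable_def)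
  finally show ?thesis .
qed

lemma abs_average_diff_le:
  fixes p :: "real ^ 'n \<Rightarrow> real"
  assumes p: "locally_integrable p" and r: "r > 0"
  shows "ennreal (\<bar>average p (cube a r) - c\<bar> * r ^ CARD('n)) \<le> (\<integral>\<^sup>+y\<in>cube a r. ennreal \<bar>p y - c\<bar> \<partial>lebesgue)"
proof -
  let ?Q = "cube a r"
  note pd = locally_integrable_cube[OF locally_integrable_diff_const[OF p, of c], of a r]
  have "(LINT y:?Q|lebesgue. p y - c) = (LINT y:?Q|lebesgue. p y) - (LINT y:?Q|lebesgue. c)"
    by (intro set_integral_diff(2) locally_integrable_cube p set_integrable_const_compact compact_cube)
  also have "(LINT y:?Q|lebesgue. c) = c * r ^ CARD('n)"
    using r by (simp add: set_lebesgue_integral_def measure_cube)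
  also have "(LINT y:?Q|lebesgue. p y) = average p ?Q * r ^ CARD('n)"
    using r by (simp add: average_def measure_cube)
  finally have "(LINT y:?Q|lebesgue. p y - c) = (average p ?Q - c) * r ^ CARD('n)"
    by (simp add: left_diff_distrib)
  then have "\<bar>average p ?Q - c\<bar> * r ^ CARD('n) = norm (LINT y:?Q|lebesgue. p y - c)"
    using r by (simp add: abs_mult)
  also have "\<dots> \<le> (LINT y:?Q|lebesgue. \<bar>p y - c\<bar>)"
    using set_integral_norm_bound[OF pd] by simp
  finally show ?thesis
    using set_nn_integral_eq_set_integral[OF set_integrable_abs[OF pd]] by (simp add: ennreal_leI)
qed

lemma bmo_bounded_cube:
  fixes p :: "real ^ 'n \<Rightarrow> real"
  assumes "bmo_bounded p \<beta>" "r > 0"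
  shows "(\<integral>\<^sup>+y\<in>cube a r. ennreal \<bar>p y - average p (cube a r)\<bar> \<partial>lebesgue) \<le> ennreal (\<beta> * r ^ CARD('n))"
  using assms cube_in_cubes[of r a] emeasure_cube[of r a]
  by (auto simp: bmo_bounded_def ennreal_mult')

text \<open>With c the average over the larger cube Q', |p_Q - c| |Q| is at most the integral of |p
  - c| over Q, hence over Q', hence at most \<beta> |Q'|. Changing the average thus costs \<beta>
  times the volume ratio.\<close>

lemma average_diff_subcube:
  fixes p :: "real ^ 'n \<Rightarrow> real"
  assumes p: "bmo_bounded p \<beta>" and r: "r > 0" "r' > 0" and sub: "cube a r \<subseteq> cube a' r'"
  shows "\<bar>average p (cube a r) - average p (cube a' r')\<bar> * r ^ CARD('n) \<le> \<beta> * r' ^ CARD('n)"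
proof -
  let ?c = "average p (cube a' r')"
  have "ennreal (\<bar>average p (cube a r) - ?c\<bar> * r ^ CARD('n)) \<le> (\<integral>\<^sup>+y\<in>cube a r. ennreal \<bar>p y - ?c\<bar> \<partial>lebesgue)"
    using p r by (intro abs_average_diff_le) (auto simp: bmo_bounded_def)
  also have "\<dots> \<le> (\<integral>\<^sup>+y\<in>cube a' r'. ennreal \<bar>p y - ?c\<bar> \<partial>lebesgue)"
    using sub by (intro nn_integral_mono) (auto simp: indicator_def)
  also have "\<dots> \<le> ennreal (\<beta> * r' ^ CARD('n))" by (rule bmo_bounded_cube[OF p r(2)])
  finally show ?thesis using p r by (subst (asm) ennreal_le_iff) (auto simp: bmo_bounded_def)
qed

text \<open>Lebesgue differentiation along cubes whose lower corner is x. The stopping cubes below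
  have this shape, so they start at the point itself instead of coming from a dyadic grid.\<close>

lemma small_cube_integral_gt:
  fixes h :: "real ^ 'n \<Rightarrow> real"
  assumes h: "locally_integrable h" and nonneg: "\<And>x. h x \<ge> 0"
  obtains N where "N \<in> null_sets lebesgue"
    "\<And>x T. x \<notin> N \<Longrightarrow> T < h x \<Longrightarrow> T \<ge> 0 \<Longrightarrow>
       \<exists>d>0. \<forall>s. 0 < s \<and> s < d \<longrightarrow> ennreal (T * s ^ CARD('n)) \<le> (\<integral>\<^sup>+y\<in>cube x s. ennreal (h y) \<partial>lebesgue)"
proof -
  have "h integrable_on cbox a b" for a b
    using h by (intro set_lebesgue_integral_eq_integral(1)) (auto simp: locally_integrable_def)
  from integrable_ccontinuous_explicit[OF this]
  obtain N where N: "negligible N" "\<And>x e. x \<notin> N \<Longrightarrow> 0 < e \<Longrightarrow>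
      \<exists>d>0. \<forall>s. 0 < s \<and> s < d \<longrightarrow> norm (integral (cbox x (x + s *\<^sub>R One)) h /\<^sub>R s ^ DIM(real ^ 'n) - h x) < e"
    by blast
  show ?thesis
  proof
    show "N \<in> null_sets lebesgue" using N(1) by (simp add: negligible_iff_null_sets)
    fix x T assume x: "x \<notin> N" "T < h x" "T \<ge> 0"
    then obtain d where d: "d > 0" "\<And>s. 0 < s \<and> s < d \<Longrightarrow> \<bar>integral (cube x s) h / s ^ CARD('n) - h x\<bar> < h x - T"
      using N(2)[of x "h x - T"] by (auto simp: cube_eq_One divide_inverse_commute)
    have "ennreal (T * s ^ CARD('n)) \<le> (\<integral>\<^sup>+y\<in>cube x s. ennreal (h y) \<partial>lebesgue)" if s: "0 < s" "s < d" for s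
    proof -
      have "T < integral (cube x s) h / s ^ CARD('n)" using d(2)[of s] s by linarith
      then have "T * s ^ CARD('n) \<le> integral (cube x s) h" using s by (simp add: field_simps)
      also have "\<dots> = (LINT y:cube x s|lebesgue. h y)"
        by (rule set_lebesgue_integral_eq_integral(2)[symmetric, OF locally_integrable_cube[OF h]])
      finally show ?thesis
        using set_nn_integral_eq_set_integral[OF locally_integrable_cube[OF h] nonneg] by (simp add: ennreal_leI)
    qed
    then show "\<exists>d>0. \<forall>s. 0 < s \<and> s < d \<longrightarrow> ennreal (T * s ^ CARD('n)) \<le> (\<integral>\<^sup>+y\<in>cube x s. ennreal (h y) \<partial>lebesgue)"
      using d(1) by blast
  qed
qed

text \<open>Times \<beta> this is the stopping level. The integral of |p - p_Q| over the doubled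
  cube is at most 2 ^ n (1 + 2 ^ n) \<beta> r ^ n; the factor 2 * \<open>dilation_ratio\<close>
  makes the dilated stopping cubes have total volume at most half of r ^ n.\<close>

definition jn_threshold :: "'n itself \<Rightarrow> real" where
  "jn_threshold n = 2 * dilation_ratio n * (2 ^ CARD('n) * (1 + 2 ^ CARD('n)))"

text \<open>In units of \<beta>: the first summand bounds the distance from p_Q to the average over
  a stopping cube, the second the change of that average on passing to the dilated cube.\<close>

definition jn_step :: "'n itself \<Rightarrow> real" where
  "jn_step n = 2 ^ CARD('n) * jn_threshold n + dilation_ratio n"

lemma jn_threshold_gt: "jn_threshold TYPE('n::finite) > 2 ^ CARD('n) * (1 + 2 ^ CARD('n))"
proof -
  have "1 * (2 ^ CARD('n) * (1 + 2 ^ CARD('n))) < (2 * dilation_ratio TYPE('n)) * (2 ^ CARD('n) * (1 + 2 ^ CARD('n)))"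
    using dilation_ratio_ge_1[where 'n='n] by (intro mult_strict_right_mono) (auto simp: add_pos_pos)
  then show ?thesis by (simp add: jn_threshold_def)
qed

lemma jn_step_ge_threshold: "jn_step TYPE('n::finite) \<ge> jn_threshold TYPE('n)"
proof -
  have "jn_threshold TYPE('n) \<ge> 0"
    using jn_threshold_gt[where 'n='n] by (smt (verit) zero_le_power mult_nonneg_nonneg)
  then have "1 * jn_threshold TYPE('n) \<le> 2 ^ CARD('n) * jn_threshold TYPE('n)"
    by (intro mult_right_mono one_le_power) auto
  then show ?thesis using dilation_ratio_ge_1[where 'n='n] by (simp add: jn_step_def)
qed

lemma jn_step_pos: "jn_step TYPE('n::finite) > 0"
  using jn_step_ge_threshold[where 'n='n] jn_threshold_gt[where 'n='n]
  by (smt (verit) zero_le_power mult_nonneg_nonneg)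

text \<open>Calderon--Zygmund stopping: around almost every point where \<open>\<bar>p - p\<^sub>Q\<bar>\<close> is large take the cube
  \<open>[x, x + r / 2 ^ m]\<close> with \<open>m\<close> minimal such that the average of \<open>\<bar>p - p\<^sub>Q\<bar>\<close> exceeds the threshold.
  The averages over these cubes are controlled from both sides, and after the covering lemma the
  oscillation of \<open>p\<close> on each of them is again governed by the hypothesis.\<close>

lemma jn_level_step:
  fixes p :: "real ^ 'n \<Rightarrow> real"
  assumes p: "bmo_bounded p \<beta>" and c: "c \<ge> 0" and t: "t \<ge> 0" and r: "r > 0"
    and hyp: "\<And>a r. r > 0 \<Longrightarrow> emeasure lebesgue {x \<in> cube a r. t < \<bar>p x - average p (cube a r)\<bar>} \<le> ennreal c * ennreal (r ^ CARD('n))"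
  shows "emeasure lebesgue {x \<in> cube a r. t + jn_step TYPE('n) * \<beta> < \<bar>p x - average p (cube a r)\<bar>}
           \<le> ennreal (c / 2) * ennreal (r ^ CARD('n))"
proof -
  let ?n = "CARD('n)" and ?D = "dilation_ratio TYPE('n)"
  define c1 :: real where "c1 = 2 ^ ?n * (1 + 2 ^ ?n)"
  define T where "T = jn_threshold TYPE('n) * \<beta>"
  define q where "q = average p (cube a r)"
  define h where "h = (\<lambda>x. \<bar>p x - q\<bar>)"
  \<comment> \<open>Stopping cubes have their lower corner in the given cube and side at most r, so
    they may leave it but stay inside \<open>P\<close>.\<close>
  define P where "P = cube a (2 * r)"
  have \<beta>: "\<beta> > 0" and li: "locally_integrable p" using p by (auto simp: bmo_bounded_def)
  have [measurable]: "p \<in> borel_measurable lebesgue" by (rule locally_integrable_measurable[OF li])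
  have D: "?D \<ge> 1" by (rule dilation_ratio_ge_1)
  have c1: "c1 > 0" by (simp add: c1_def add_pos_pos)
  have T: "T > c1 * \<beta>" "T > 0"
    using jn_threshold_gt[where 'n='n] \<beta> c1 by (auto simp: T_def c1_def intro: order.strict_trans[of _ "c1 * \<beta>"])
  have T2: "T = 2 * ?D * c1 * \<beta>" by (simp add: T_def jn_threshold_def c1_def)
  have QP: "cube a r \<subseteq> P" unfolding P_def using r by (intro cube_mono) auto
  \<comment> \<open>The oscillation on \<open>P\<close> contributes 2 ^ n, and |p_Q - p_P| \<le> 2 ^
    n \<beta> on a volume of 2 ^ n r ^ n contributes 2 ^ n * 2 ^ n; together they give
    \<open>c1\<close>.\<close>
  have hP: "(\<integral>\<^sup>+y\<in>P. ennreal (h y) \<partial>lebesgue) \<le> ennreal (c1 * \<beta> * r ^ ?n)"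
  proof -
    define qP where "qP = average p P"
    have "\<bar>q - qP\<bar> * r ^ ?n \<le> \<beta> * (2 * r) ^ ?n"
      unfolding q_def qP_def P_def using r QP by (intro average_diff_subcube[OF p]) (auto simp: P_def)
    then have qq: "\<bar>q - qP\<bar> \<le> \<beta> * 2 ^ ?n" using r by (simp add: power_mult_distrib)
    have "(\<integral>\<^sup>+y\<in>P. ennreal (h y) \<partial>lebesgue) \<le> (\<integral>\<^sup>+y. ennreal \<bar>p y - qP\<bar> * indicator P y + ennreal (\<beta> * 2 ^ ?n) * indicator P y \<partial>lebesgue)"
      using qq \<beta> by (intro nn_integral_mono) (auto simp: h_def indicator_def ennreal_plus[symmetric] simp del: ennreal_plus)
    also have "\<dots> = (\<integral>\<^sup>+y\<in>P. ennreal \<bar>p y - qP\<bar> \<partial>lebesgue) + ennreal (\<beta> * 2 ^ ?n) * emeasure lebesgue P"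
      by (subst nn_integral_add) (auto simp: P_def nn_integral_cmult_indicator)
    also have "\<dots> \<le> ennreal (\<beta> * (2 * r) ^ ?n) + ennreal (\<beta> * 2 ^ ?n) * ennreal ((2 * r) ^ ?n)"
      unfolding P_def qP_def using r bmo_bounded_cube[OF p, of "2 * r" a] by (intro add_mono) (auto simp: emeasure_cube)
    also have "\<dots> = ennreal (c1 * \<beta> * r ^ ?n)"
      using r \<beta> by (simp add: ennreal_mult[symmetric] ennreal_plus[symmetric] c1_def power_mult_distrib algebra_simps del: ennreal_plus)
    finally show ?thesis .
  qed
  \<comment> \<open>Truncation to \<open>P\<close> gives the finite total integral demanded by
    \<open>cube_covering\<close>; on the cubes in \<open>F\<close> it changes nothing.\<close>
  define g where "g = (\<lambda>y. ennreal (h y) * indicator P y)"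
  have g [measurable]: "g \<in> borel_measurable lebesgue" unfolding g_def h_def P_def by measurable
  have sub: "cube x s \<subseteq> P" if "x \<in> cube a r" "s \<le> r" for x s
    unfolding P_def
  proof (rule cube_mono)
    fix i
    have "a $ i \<le> x $ i" "x $ i \<le> a $ i + r" using that(1) by (auto simp: mem_cube)
    then show "a $ i \<le> x $ i" "x $ i + s \<le> a $ i + 2 * r" using that(2) by linarith+
  qed
  have g_cube: "(\<integral>\<^sup>+y\<in>cube x s. g y \<partial>lebesgue) = (\<integral>\<^sup>+y\<in>cube x s. ennreal (h y) \<partial>lebesgue)"
    if "x \<in> cube a r" "s \<le> r" for x s
    using sub[OF that] unfolding g_def by (intro nn_integral_cong) (auto simp: indicator_def)
  \<comment> \<open>The lower bound feeds \<open>cube_covering\<close>. The factor 2 ^ n in the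
    upper bound is the volume ratio of a stopping cube to its predecessor of twice the side, whose
    mean is still below T.\<close>
  define F where "F = {(x, s). x \<in> cube a r \<and> 0 < s \<and> s \<le> r
     \<and> ennreal (T * s ^ ?n) \<le> (\<integral>\<^sup>+y\<in>cube x s. ennreal (h y) \<partial>lebesgue)
     \<and> (\<integral>\<^sup>+y\<in>cube x s. ennreal (h y) \<partial>lebesgue) \<le> ennreal (2 ^ ?n * T * s ^ ?n)}"
  obtain C where C: "countable C" "C \<subseteq> F"
    "\<And>x s. (x, s) \<in> F \<Longrightarrow> \<exists>(x', s')\<in>C. cube x s \<subseteq> dilated_cube x' s'"
    "ennreal T * (\<integral>\<^sup>+q. ennreal (snd q ^ ?n) \<partial>count_space C) \<le> (\<integral>\<^sup>+x. g x \<partial>lebesgue)"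
  proof (rule cube_covering[of g T F])
    show "(\<integral>\<^sup>+x. g x \<partial>lebesgue) < \<infinity>"
      using hP unfolding g_def by (auto intro: order.strict_trans1)
    show "0 < s \<and> ennreal T * ennreal (s ^ ?n) \<le> (\<integral>\<^sup>+y\<in>cube x s. g y \<partial>lebesgue)" if "(x, s) \<in> F" for x s
      using that T g_cube[of x s] by (auto simp: F_def ennreal_mult')
  qed (use T g in auto)
  obtain N where N: "N \<in> null_sets lebesgue"
    "\<And>x T. x \<notin> N \<Longrightarrow> T < h x \<Longrightarrow> T \<ge> 0 \<Longrightarrow>
       \<exists>d>0. \<forall>s. 0 < s \<and> s < d \<longrightarrow> ennreal (T * s ^ ?n) \<le> (\<integral>\<^sup>+y\<in>cube x s. ennreal (h y) \<partial>lebesgue)"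
    using small_cube_integral_gt[of h] locally_integrable_abs[OF locally_integrable_diff_const[OF li]]
    unfolding h_def by auto
  have stop: "\<exists>s. (x, s) \<in> F" if x: "x \<in> cube a r" "x \<notin> N" "T < h x" for x
  proof -
    let ?I = "\<lambda>m. (\<integral>\<^sup>+y\<in>cube x (r / 2 ^ m). ennreal (h y) \<partial>lebesgue)"
    let ?P = "\<lambda>m. ennreal (T * (r / 2 ^ m) ^ ?n) \<le> ?I m"
    obtain d where d: "d > 0" "\<And>s. 0 < s \<and> s < d \<Longrightarrow> ennreal (T * s ^ ?n) \<le> (\<integral>\<^sup>+y\<in>cube x s. ennreal (h y) \<partial>lebesgue)"
      using N(2)[OF x(2,3)] T by auto
    obtain m0 where "r / d < 2 ^ m0" using real_arch_pow[of 2 "r / d"] by auto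
    then have "?P m0" using d(1) r by (intro d(2)) (auto simp: field_simps)
    define m where "m = (LEAST m. ?P m)"
    have m: "?P m" unfolding m_def by (rule LeastI[of ?P]) fact
    \<comment> \<open>At full side r the mean is at most \<open>c1 * \<beta>\<close>, which is below
      T, so the minimal index has a predecessor.\<close>
    have "\<not> ?P 0"
    proof
      assume "?P 0"
      then have "ennreal (T * r ^ ?n) \<le> (\<integral>\<^sup>+y\<in>cube x r. ennreal (h y) \<partial>lebesgue)" by simp
      also have "\<dots> \<le> (\<integral>\<^sup>+y\<in>P. ennreal (h y) \<partial>lebesgue)"
        using sub[OF x(1)] by (intro nn_integral_mono) (auto simp: indicator_def)
      also note hP
      finally have "T * r ^ ?n \<le> c1 * \<beta> * r ^ ?n" using c1 \<beta> r by (subst (asm) ennreal_le_iff) auto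
      then show False using T r by simp
    qed
    then obtain k where k: "m = Suc k" using m by (cases m) auto
    have nk: "\<not> ?P k" using not_less_Least[of k ?P] k unfolding m_def by auto
    have le: "r / 2 ^ j \<le> r" for j :: nat using r by (simp add: field_simps)
    have "cube x (r / 2 ^ m) \<subseteq> cube x (r / 2 ^ k)"
      using r k by (intro cube_mono) (auto simp: field_simps)
    then have "?I m \<le> ?I k" by (intro nn_integral_mono) (auto simp: indicator_def)
    also have "\<dots> \<le> ennreal (T * (r / 2 ^ k) ^ ?n)" using nk by simp
    also have "T * (r / 2 ^ k) ^ ?n = 2 ^ ?n * T * (r / 2 ^ m) ^ ?n"
      unfolding k by (simp add: power_divide power_mult_distrib)
    finally have "(x, r / 2 ^ m) \<in> F" using m x(1) r le[of m] by (simp add: F_def)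
    then show ?thesis ..
  qed
  \<comment> \<open>On each dilated cube the hypothesis is applied at level t relative to that
    cube's own average.\<close>
  let ?E = "\<lambda>z. {y \<in> dilated_cube (fst z) (snd z). t < \<bar>p y - average p (dilated_cube (fst z) (snd z))\<bar>}"
  have incl: "{x \<in> cube a r. t + jn_step TYPE('n) * \<beta> < h x} \<subseteq> N \<union> (\<Union>z\<in>C. ?E z)"
  proof
    fix x assume "x \<in> {x \<in> cube a r. t + jn_step TYPE('n) * \<beta> < h x}"
    then have x: "x \<in> cube a r" "t + jn_step TYPE('n) * \<beta> < h x" by auto
    have "T \<le> jn_step TYPE('n) * \<beta>"
      unfolding T_def using jn_step_ge_threshold \<beta> by (intro mult_right_mono) auto
    then have Th: "T < h x" using x t by linarith
    show "x \<in> N \<union> (\<Union>z\<in>C. ?E z)"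
    proof (cases "x \<in> N")
      case False
      obtain s where s: "(x, s) \<in> F" using stop[OF x(1) False Th] by auto
      then obtain u v where z: "(u, v) \<in> C" "cube x s \<subseteq> dilated_cube u v"
        using C(3)[OF s] by auto
      have uv: "u \<in> cube a r" "v > 0" "v \<le> r" "(\<integral>\<^sup>+y\<in>cube u v. ennreal (h y) \<partial>lebesgue) \<le> ennreal (2 ^ ?n * T * v ^ ?n)"
        using z(1) C(2) by (auto simp: F_def)
      have "x \<in> cube x s" using s by (auto simp: F_def mem_cube)
      then have xu: "x \<in> dilated_cube u v" using z by auto
      have "ennreal (\<bar>average p (cube u v) - q\<bar> * v ^ ?n) \<le> ennreal (2 ^ ?n * T * v ^ ?n)"
        using order_trans[OF abs_average_diff_le[OF li uv(2), of u q] uv(4)[unfolded h_def]] .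
      then have "\<bar>average p (cube u v) - q\<bar> * v ^ ?n \<le> 2 ^ ?n * T * v ^ ?n"
        using uv T by (subst (asm) ennreal_le_iff) auto
      then have 1: "\<bar>average p (cube u v) - q\<bar> \<le> 2 ^ ?n * T" using uv by simp
      have "\<bar>average p (cube u v) - average p (dilated_cube u v)\<bar> * v ^ ?n \<le> \<beta> * (10 * real ?n * v) ^ ?n"
        using uv cube_subset_dilated_cube[of v u] unfolding dilated_cube_def
        by (intro average_diff_subcube[OF p]) auto
      also have "\<dots> = \<beta> * ?D * v ^ ?n" by (simp add: power_mult_distrib)
      finally have 2: "\<bar>average p (cube u v) - average p (dilated_cube u v)\<bar> \<le> \<beta> * ?D" using uv by simp
      \<comment> \<open>Moving the centre from p_Q to the average over the dilated cube incurs the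
        two errors just bounded; \<open>jn_step\<close> is exactly their sum.\<close>
      have "jn_step TYPE('n) * \<beta> = 2 ^ ?n * T + \<beta> * ?D"
        by (simp add: jn_step_def T_def algebra_simps)
      then have "t < \<bar>p x - average p (dilated_cube u v)\<bar>"
        using x(2) 1 2 unfolding h_def by linarith
      then have "x \<in> ?E (u, v)" using xu by simp
      then show ?thesis using z(1) by blast
    qed simp
  qed
  have dil_meas [measurable]: "dilated_cube u v \<in> sets lebesgue" for u :: "real ^ 'n" and v by (simp add: dilated_cube_def)
  have E_meas: "?E z \<in> sets lebesgue" for z by measurable
  have UE: "(\<Union>z\<in>C. ?E z) \<in> sets lebesgue" using C(1) E_meas by (intro sets.countable_UN'') auto
  have "emeasure lebesgue {x \<in> cube a r. t + jn_step TYPE('n) * \<beta> < h x} \<le> emeasure lebesgue (N \<union> (\<Union>z\<in>C. ?E z))"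
    using incl N(1) UE by (intro emeasure_mono) auto
  also have "\<dots> \<le> emeasure lebesgue N + emeasure lebesgue (\<Union>z\<in>C. ?E z)"
    using N(1) UE by (intro emeasure_subadditive) auto
  also have "\<dots> = emeasure lebesgue (\<Union>z\<in>C. ?E z)" using N(1) by (simp add: null_setsD1)
  also have "\<dots> \<le> (\<integral>\<^sup>+z. emeasure lebesgue (?E z) \<partial>count_space C)"
    by (intro emeasure_UN_le_count_space C E_meas)
  also have "\<dots> \<le> (\<integral>\<^sup>+z. ennreal (c * ?D) * ennreal (snd z ^ ?n) \<partial>count_space C)"
  proof (intro nn_integral_mono)
    fix z assume "z \<in> space (count_space C)"
    then have z: "snd z > 0" using C(2) by (auto simp: F_def)
    have "emeasure lebesgue (?E z) \<le> ennreal c * ennreal ((10 * real ?n * snd z) ^ ?n)"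
      unfolding dilated_cube_def using z by (intro hyp) auto
    also have "\<dots> = ennreal (c * ?D) * ennreal (snd z ^ ?n)"
      using c z by (simp add: ennreal_mult[symmetric] power_mult_distrib mult.assoc)
    finally show "emeasure lebesgue (?E z) \<le> ennreal (c * ?D) * ennreal (snd z ^ ?n)" .
  qed
  also have "\<dots> = ennreal (c * ?D) * (\<integral>\<^sup>+z. ennreal (snd z ^ ?n) \<partial>count_space C)"
    by (simp add: nn_integral_cmult)
  \<comment> \<open>The covering bounds the sum of volumes by c1 \<beta> r ^ n / T, and T = 2 D c1
    \<beta> leaves the factor 1 / 2.\<close>
  also have "\<dots> = ennreal (c * ?D / T) * (ennreal T * (\<integral>\<^sup>+z. ennreal (snd z ^ ?n) \<partial>count_space C))"
    using T c by (simp add: mult.assoc[symmetric] ennreal_mult[symmetric])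
  also have "\<dots> \<le> ennreal (c * ?D / T) * ennreal (c1 * \<beta> * r ^ ?n)"
    using C(4) hP unfolding g_def by (intro mult_left_mono) auto
  also have "\<dots> = ennreal (c / 2) * ennreal (r ^ ?n)"
    using T c c1 \<beta> r D by (simp add: ennreal_mult[symmetric] T2)
  finally show ?thesis by (simp add: h_def q_def)
qed

text \<open>Iteration of \<open>jn_level_step\<close>. The induction runs over all cubes at once,
  because the step applies the hypothesis to dilated cubes, which need not lie in the original
  one.\<close>

lemma jn_decay:
  fixes p :: "real ^ 'n \<Rightarrow> real"
  assumes p: "bmo_bounded p \<beta>" and r: "r > 0"
  shows "emeasure lebesgue {x \<in> cube a r. real m * (jn_step TYPE('n) * \<beta>) < \<bar>p x - average p (cube a r)\<bar>}
           \<le> ennreal ((1 / 2) ^ m) * ennreal (r ^ CARD('n))"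
  using r
proof (induction m arbitrary: a r)
  case 0
  have "emeasure lebesgue {x \<in> cube a r. 0 < \<bar>p x - average p (cube a r)\<bar>} \<le> emeasure lebesgue (cube a r)"
    by (intro emeasure_mono) auto
  then show ?case using 0 by (simp add: emeasure_cube)
next
  case (Suc m)
  have \<beta>: "\<beta> > 0" using p by (simp add: bmo_bounded_def)
  have "emeasure lebesgue {x \<in> cube a r. real m * (jn_step TYPE('n) * \<beta>) + jn_step TYPE('n) * \<beta> < \<bar>p x - average p (cube a r)\<bar>}
     \<le> ennreal ((1 / 2) ^ m / 2) * ennreal (r ^ CARD('n))"
    using Suc jn_step_pos[where 'n='n] \<beta> by (intro jn_level_step[OF p]) auto
  then show ?case by (simp add: algebra_simps)
qed

text \<open>Along levels of spacing \<open>jn_step\<close> times \<beta> the measure decays like (1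
  / 2) ^ m, while the exponential with this rate grows by 6 / 5 per level. With the weights 1 / 5 *
  (6 / 5) ^ m the series has ratio 3 / 5 and sum exactly 1 / 2.\<close>

definition jn_rate :: "'n itself \<Rightarrow> real" where
  "jn_rate n = ln (6 / 5) / jn_step n"

lemma jn_rate_pos: "jn_rate TYPE('n::finite) > 0"
  using jn_step_pos[where 'n='n] by (simp add: jn_rate_def)

text \<open>A discrete layer cake: with M the ceiling of u / A the exponential is at most (6 / 5) ^
  M, which telescopes to 1 plus the terms with m < M, and each such m satisfies m A < u.\<close>

lemma exp_le_layer_sum:
  fixes u A :: real
  assumes u: "u \<ge> 0" and A: "A > 0"
  shows "ennreal (exp (ln (6 / 5) / A * u) - 1) \<le> (\<Sum>m. ennreal (1 / 5 * (6 / 5) ^ m) * of_bool (real m * A < u))"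
proof -
  define M where "M = nat \<lceil>u / A\<rceil>"
  have uA: "u / A \<ge> 0" using u A by simp
  have M: "u / A \<le> real M" unfolding M_def by linarith
  have small: "real m * A < u" if "m < M" for m
  proof -
    have "real m < u / A" using that unfolding M_def by linarith
    then show ?thesis using A by (simp add: field_simps)
  qed
  have "exp (ln (6 / 5) / A * u) = exp (ln (6 / 5) * (u / A))" by simp
  also have "\<dots> \<le> exp (ln (6 / 5) * real M)" using mult_left_mono[OF M, of "ln (6 / 5)"] by simp
  also have "\<dots> = (6 / 5) ^ M" by (subst exp_of_nat2_mult) simp
  also have "\<dots> = 1 + (\<Sum>m<M. 1 / 5 * (6 / 5) ^ m)"
    by (induction M) (auto simp: field_simps)
  finally have "exp (ln (6 / 5) / A * u) - 1 \<le> (\<Sum>m<M. 1 / 5 * (6 / 5) ^ m)" by simp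
  then have "ennreal (exp (ln (6 / 5) / A * u) - 1) \<le> (\<Sum>m<M. ennreal (1 / 5 * (6 / 5) ^ m))"
    by (subst sum_ennreal) (auto intro: ennreal_leI)
  also have "\<dots> = (\<Sum>m<M. ennreal (1 / 5 * (6 / 5) ^ m) * of_bool (real m * A < u))"
    using small by (intro sum.cong) auto
  also have "\<dots> \<le> (\<Sum>m. ennreal (1 / 5 * (6 / 5) ^ m) * of_bool (real m * A < u))"
    by (intro sum_le_suminf) auto
  finally show ?thesis .
qed

text \<open>Both the subtracted 1 and the value 1 / 2 are tailored to the absorption in
  \<open>weak_type_average_of_osc\<close>, where this integral must stay a proper fraction of
  |Q|.\<close>

lemma john_nirenberg:
  fixes p :: "real ^ 'n \<Rightarrow> real"
  assumes p: "bmo_bounded p \<beta>" and r: "r > 0"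
  shows "(\<integral>\<^sup>+y\<in>cube a r. ennreal (exp (jn_rate TYPE('n) / \<beta> * \<bar>p y - average p (cube a r)\<bar>) - 1) \<partial>lebesgue)
           \<le> ennreal (1 / 2 * r ^ CARD('n))"
proof -
  let ?Q = "cube a r" and ?A = "jn_step TYPE('n) * \<beta>"
  let ?h = "\<lambda>y. \<bar>p y - average p ?Q\<bar>"
  have \<beta>: "\<beta> > 0" and li: "locally_integrable p" using p by (auto simp: bmo_bounded_def)
  have [measurable]: "p \<in> borel_measurable lebesgue" by (rule locally_integrable_measurable[OF li])
  have A: "?A > 0" using \<beta> jn_step_pos[where 'n='n] by simp
  have "(\<integral>\<^sup>+y\<in>?Q. ennreal (exp (jn_rate TYPE('n) / \<beta> * ?h y) - 1) \<partial>lebesgue)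
     \<le> (\<integral>\<^sup>+y. (\<Sum>m. ennreal (1 / 5 * (6 / 5) ^ m) * indicator {x \<in> ?Q. real m * ?A < ?h x} y) \<partial>lebesgue)"
  proof (intro nn_integral_mono)
    fix y
    show "ennreal (exp (jn_rate TYPE('n) / \<beta> * ?h y) - 1) * indicator ?Q y
      \<le> (\<Sum>m. ennreal (1 / 5 * (6 / 5) ^ m) * indicator {x \<in> ?Q. real m * ?A < ?h x} y)"
      using exp_le_layer_sum[of "?h y" ?A] A by (cases "y \<in> ?Q") (auto simp: jn_rate_def indicator_def)
  qed
  also have "\<dots> = (\<Sum>m. \<integral>\<^sup>+y. ennreal (1 / 5 * (6 / 5) ^ m) * indicator {x \<in> ?Q. real m * ?A < ?h x} y \<partial>lebesgue)"
    by (intro nn_integral_suminf) measurable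
  also have "\<dots> = (\<Sum>m. ennreal (1 / 5 * (6 / 5) ^ m) * emeasure lebesgue {x \<in> ?Q. real m * ?A < ?h x})"
    by (intro arg_cong[of _ _ suminf] ext nn_integral_cmult_indicator) measurable
  also have "\<dots> \<le> (\<Sum>m. ennreal (1 / 5 * r ^ CARD('n) * (3 / 5) ^ m))"
  proof (intro suminf_le)
    fix m
    have "ennreal (1 / 5 * (6 / 5) ^ m) * emeasure lebesgue {x \<in> ?Q. real m * ?A < ?h x}
       \<le> ennreal (1 / 5 * (6 / 5) ^ m) * (ennreal ((1 / 2) ^ m) * ennreal (r ^ CARD('n)))"
      by (intro mult_left_mono jn_decay[OF p r]) auto
    also have "\<dots> = ennreal (1 / 5 * r ^ CARD('n) * (6 / 5 * (1 / 2)) ^ m)"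
      using r unfolding power_mult_distrib by (simp add: ennreal_mult[symmetric])
    finally show "ennreal (1 / 5 * (6 / 5) ^ m) * emeasure lebesgue {x \<in> ?Q. real m * ?A < ?h x} \<le> ennreal (1 / 5 * r ^ CARD('n) * (3 / 5) ^ m)"
      by simp
  qed auto
  also have "\<dots> = ennreal (1 / 2 * r ^ CARD('n))"
  proof (rule suminf_ennreal_eq)
    have "(\<lambda>m. (1 / 5 * r ^ CARD('n)) * (3 / 5) ^ m) sums ((1 / 5 * r ^ CARD('n)) * (1 / (1 - 3 / 5)))"
      by (intro sums_mult geometric_sums) auto
    then show "(\<lambda>m. 1 / 5 * r ^ CARD('n) * (3 / 5) ^ m) sums (1 / 2 * r ^ CARD('n))" by simp
  qed (use r in auto)
  finally show ?thesis .
qed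

text \<open>From u ^ 2 \<le> 2 (e ^ u - 1) for u \<ge> 0, with u equal to \<open>jn_rate\<close> /
  \<beta> times the oscillation.\<close>

lemma bmo_second_moment:
  fixes p :: "real ^ 'n \<Rightarrow> real"
  assumes p: "bmo_bounded p \<beta>" and r: "r > 0"
  shows "(\<integral>\<^sup>+y\<in>cube a r. ennreal ((p y - average p (cube a r))\<^sup>2) \<partial>lebesgue)
           \<le> ennreal ((\<beta> / jn_rate TYPE('n))\<^sup>2 * r ^ CARD('n))"
proof -
  let ?Q = "cube a r" and ?k = "jn_rate TYPE('n) / \<beta>"
  let ?h = "\<lambda>y. \<bar>p y - average p ?Q\<bar>"
  have \<beta>: "\<beta> > 0" and li: "locally_integrable p" using p by (auto simp: bmo_bounded_def)
  have [measurable]: "p \<in> borel_measurable lebesgue" by (rule locally_integrable_measurable[OF li])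
  have k: "?k > 0" using \<beta> jn_rate_pos[where 'n='n] by simp
  have "(p y - average p ?Q)\<^sup>2 \<le> 2 / ?k\<^sup>2 * (exp (?k * ?h y) - 1)" for y
  proof -
    have "u\<^sup>2 \<le> 2 * (exp u - 1)" if "u \<ge> 0" for u :: real
      using exp_lower_Taylor_quadratic[OF that] that by simp
    then have "(?k * ?h y)\<^sup>2 \<le> 2 * (exp (?k * ?h y) - 1)"
      using mult_nonneg_nonneg[OF less_imp_le[OF k] abs_ge_zero] by blast
    from divide_right_mono[OF this zero_le_power2[of ?k]]
    have "(?k * ?h y)\<^sup>2 / ?k\<^sup>2 \<le> 2 / ?k\<^sup>2 * (exp (?k * ?h y) - 1)"
      by (simp only: times_divide_eq_left)
    moreover have "(?k * ?h y)\<^sup>2 / ?k\<^sup>2 = (p y - average p ?Q)\<^sup>2"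
      unfolding power_mult_distrib power2_abs using k by (intro nonzero_mult_div_cancel_left) auto
    ultimately show ?thesis by simp
  qed
  then have "(\<integral>\<^sup>+y\<in>?Q. ennreal ((p y - average p ?Q)\<^sup>2) \<partial>lebesgue)
      \<le> (\<integral>\<^sup>+y. ennreal (2 / ?k\<^sup>2) * (ennreal (exp (?k * ?h y) - 1) * indicator ?Q y) \<partial>lebesgue)"
    by (intro nn_integral_mono) (auto simp: indicator_def ennreal_mult'[symmetric] intro: ennreal_leI)
  also have "\<dots> = ennreal (2 / ?k\<^sup>2) * (\<integral>\<^sup>+y\<in>?Q. ennreal (exp (?k * ?h y) - 1) \<partial>lebesgue)"
    by (intro nn_integral_cmult) measurable
  also have "\<dots> \<le> ennreal (2 / ?k\<^sup>2) * ennreal (1 / 2 * r ^ CARD('n))"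
    by (intro mult_left_mono john_nirenberg[OF p r]) auto
  also have "\<dots> = ennreal ((\<beta> / jn_rate TYPE('n))\<^sup>2 * r ^ CARD('n))"
    using r by (simp add: ennreal_mult[symmetric] power_divide)
  finally show ?thesis .
qed

section \<open>The weak type estimates\<close>

text \<open>With c the average over the fixed cube, an oscillation above 2 t forces |p x - c| \<ge>
  t or |p_Q - c| \<ge> t. Chebyshev bounds the first set, the weak type inequality for (p - c) ^ 2
  restricted to the fixed cube the second; hence the factor 1 +
  \<open>dilation_ratio\<close>.\<close>

lemma outer_measure_osc_level:
  fixes p :: "real ^ 'n \<Rightarrow> real"
  assumes p: "bmo_bounded p \<beta>" and v: "v > 0" and t: "t > 0"
  shows "ennreal (t\<^sup>2) * outer_measure_of lebesgue {x. \<exists>Q\<in>cubes. x \<in> Q \<and> Q \<subseteq> cube u v \<and> 2 * t < \<bar>p x - average p Q\<bar>}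
         \<le> ennreal ((1 + dilation_ratio TYPE('n)) * (\<beta> / jn_rate TYPE('n))\<^sup>2 * v ^ CARD('n))"
    (is "_ * outer_measure_of _ ?S \<le> _")
proof -
  let ?n = "CARD('n)" and ?D = "dilation_ratio TYPE('n)" and ?P = "cube u v"
  define c where "c = average p ?P"
  define G where "G = (\<lambda>y. ennreal ((p y - c)\<^sup>2) * indicator ?P y)"
  have li: "locally_integrable p" using p by (auto simp: bmo_bounded_def)
  have pm [measurable]: "p \<in> borel_measurable lebesgue" by (rule locally_integrable_measurable[OF li])
  have G [measurable]: "G \<in> borel_measurable lebesgue" unfolding G_def by measurable
  have D: "?D \<ge> 1" by (rule dilation_ratio_ge_1)
  have intG: "(\<integral>\<^sup>+y. G y \<partial>lebesgue) \<le> ennreal ((\<beta> / jn_rate TYPE('n))\<^sup>2 * v ^ ?n)"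
    unfolding G_def c_def by (rule bmo_second_moment[OF p v])
  let ?A = "{x. ennreal (t\<^sup>2) \<le> G x}"
  let ?B = "{x. \<exists>Q\<in>cubes. x \<in> Q \<and> ennreal (t\<^sup>2) * emeasure lebesgue Q \<le> (\<integral>\<^sup>+y\<in>Q. G y \<partial>lebesgue)}"
  have "{x \<in> space lebesgue. ennreal (t\<^sup>2) \<le> G x} \<in> sets lebesgue" by measurable
  then have A_meas: "?A \<in> sets lebesgue" by simp
  have "?S \<subseteq> ?A \<union> ?B"
  proof
    fix x assume "x \<in> ?S"
    then obtain Q where Q: "Q \<in> cubes" "x \<in> Q" "Q \<subseteq> ?P" "2 * t < \<bar>p x - average p Q\<bar>" by auto
    then obtain a r where ar: "r > 0" "Q = cube a r" by (auto simp: cubes_iff)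
    show "x \<in> ?A \<union> ?B"
    proof (cases "t \<le> \<bar>p x - c\<bar>")
      case True
      then have "t\<^sup>2 \<le> (p x - c)\<^sup>2" using t by (simp add: abs_le_square_iff[symmetric])
      then show ?thesis using Q by (auto simp: G_def intro!: ennreal_leI)
    next
      case False
      then have avg: "t \<le> \<bar>average p Q - c\<bar>" using Q(4) by linarith
      have "ennreal (t * r ^ ?n) \<le> ennreal (\<bar>average p Q - c\<bar> * r ^ ?n)"
        using avg ar by (intro ennreal_leI mult_right_mono) auto
      also have "\<dots> \<le> (\<integral>\<^sup>+y\<in>Q. ennreal \<bar>p y - c\<bar> \<partial>lebesgue)"
        unfolding ar(2) by (rule abs_average_diff_le[OF li ar(1)])
      \<comment> \<open>In place of Cauchy-Schwarz, 2 t |p - c| \<le> t ^ 2 + (p - c) ^ 2 yields 2 t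
        ^ 2 |Q| \<le> t ^ 2 |Q| plus the integral of \<open>G\<close> over Q, and one finite copy of
        t ^ 2 |Q| cancels.\<close>
      finally have "ennreal (2 * t) * ennreal (t * r ^ ?n) \<le> ennreal (2 * t) * (\<integral>\<^sup>+y\<in>Q. ennreal \<bar>p y - c\<bar> \<partial>lebesgue)"
        by (intro mult_left_mono) auto
      also have "\<dots> = (\<integral>\<^sup>+y. ennreal (2 * t) * (ennreal \<bar>p y - c\<bar> * indicator Q y) \<partial>lebesgue)"
        unfolding ar(2) by (intro nn_integral_cmult[symmetric]) measurable
      also have "\<dots> \<le> (\<integral>\<^sup>+y. ennreal (t\<^sup>2) * indicator Q y + G y * indicator Q y \<partial>lebesgue)"
      proof (intro nn_integral_mono)
        fix y
        have "2 * t * \<bar>p y - c\<bar> \<le> t\<^sup>2 + (p y - c)\<^sup>2"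
          using sum_squares_bound[of t "\<bar>p y - c\<bar>"] by simp
        then have "ennreal (2 * t * \<bar>p y - c\<bar>) \<le> ennreal (t\<^sup>2 + (p y - c)\<^sup>2)" by (rule ennreal_leI)
        then show "ennreal (2 * t) * (ennreal \<bar>p y - c\<bar> * indicator Q y) \<le> ennreal (t\<^sup>2) * indicator Q y + G y * indicator Q y"
          using Q(3) t by (auto simp: G_def indicator_def ennreal_mult'[symmetric])
      qed
      also have "\<dots> = ennreal (t\<^sup>2) * emeasure lebesgue Q + (\<integral>\<^sup>+y\<in>Q. G y \<partial>lebesgue)"
        unfolding ar(2) by (subst nn_integral_add) (auto simp: nn_integral_cmult_indicator)
      also have "ennreal (2 * t) * ennreal (t * r ^ ?n) = ennreal (t\<^sup>2) * emeasure lebesgue Q + ennreal (t\<^sup>2) * emeasure lebesgue Q"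
        using t ar by (simp add: emeasure_cube ennreal_mult[symmetric] ennreal_plus[symmetric] power2_eq_square algebra_simps del: ennreal_plus)
      finally have "ennreal (t\<^sup>2) * emeasure lebesgue Q \<le> (\<integral>\<^sup>+y\<in>Q. G y \<partial>lebesgue)"
        using ar by (simp add: ennreal_add_left_cancel_le emeasure_cube ennreal_mult_eq_top_iff)
      then show ?thesis using Q by blast
    qed
  qed
  then have "outer_measure_of lebesgue ?S \<le> outer_measure_of lebesgue (?A \<union> ?B)"
    by (rule outer_measure_of_mono)
  also have "\<dots> \<le> outer_measure_of lebesgue ?A + outer_measure_of lebesgue ?B"
    by (intro outer_measure_of_Un_le) auto
  finally have "ennreal (t\<^sup>2) * outer_measure_of lebesgue ?S
      \<le> ennreal (t\<^sup>2) * outer_measure_of lebesgue ?A + ennreal (t\<^sup>2) * outer_measure_of lebesgue ?B"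
    by (simp add: mult_left_mono flip: distrib_left)
  also have "ennreal (t\<^sup>2) * outer_measure_of lebesgue ?A = (\<integral>\<^sup>+y. ennreal (t\<^sup>2) * indicator ?A y \<partial>lebesgue)"
    using A_meas by (simp add: nn_integral_cmult_indicator)
  also have "\<dots> \<le> (\<integral>\<^sup>+y. G y \<partial>lebesgue)"
    by (intro nn_integral_mono) (auto simp: indicator_def)
  also have "ennreal (t\<^sup>2) * outer_measure_of lebesgue ?B \<le> ennreal ?D * (\<integral>\<^sup>+y. G y \<partial>lebesgue)"
    using t by (intro maximal_weak_type G) simp
  also have "(\<integral>\<^sup>+y. G y \<partial>lebesgue) + ennreal ?D * (\<integral>\<^sup>+y. G y \<partial>lebesgue) = ennreal (1 + ?D) * (\<integral>\<^sup>+y. G y \<partial>lebesgue)"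
    using D by (subst ennreal_plus) (auto simp: distrib_right)
  also have "\<dots> \<le> ennreal (1 + ?D) * ennreal ((\<beta> / jn_rate TYPE('n))\<^sup>2 * v ^ ?n)"
    by (intro mult_left_mono intG) simp
  also have "\<dots> = ennreal ((1 + ?D) * (\<beta> / jn_rate TYPE('n))\<^sup>2 * v ^ ?n)"
    unfolding mult.assoc using D v by (intro ennreal_mult[symmetric]) auto
  finally show ?thesis by (simp add: add_mono)
qed

text \<open>The 4 stems from using \<open>outer_measure_osc_level\<close> at t / 2, the factor 1 +
  \<open>dilation_ratio\<close> from the bound there, the other \<open>dilation_ratio\<close> from
  the volume of the dilated cubes.\<close>

definition level_const :: "'n itself \<Rightarrow> real" where
  "level_const n = 4 * (1 + dilation_ratio n) * dilation_ratio n / (jn_rate n)\<^sup>2"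

lemma level_const_nonneg: "level_const TYPE('n::finite) \<ge> 0"
  using dilation_ratio_ge_1[where 'n='n] by (simp add: level_const_def)

text \<open>The cubes on which the mean of \<open>g\<close> is at least \<open>s\<close> lie in
  dilated cubes of total volume at most \<open>dilation_ratio\<close> / s times the integral of
  \<open>g\<close>. Inside each of these only the oscillation condition is kept.\<close>

lemma outer_measure_average_osc_level:
  fixes p :: "real ^ 'n \<Rightarrow> real" and g :: "real ^ 'n \<Rightarrow> ennreal"
  assumes p: "bmo_bounded p \<beta>" and g: "g \<in> borel_measurable lebesgue"
    and fin: "(\<integral>\<^sup>+x. g x \<partial>lebesgue) < \<infinity>" and s: "s > 0" and t: "t > 0"
  shows "outer_measure_of lebesgue
           {x. \<exists>Q\<in>cubes. x \<in> Q \<and> ennreal s * emeasure lebesgue Q \<le> (\<integral>\<^sup>+y\<in>Q. g y \<partial>lebesgue) \<and> t < \<bar>p x - average p Q\<bar>}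
         \<le> ennreal (level_const TYPE('n) * (\<beta> / t)\<^sup>2 / s) * (\<integral>\<^sup>+x. g x \<partial>lebesgue)"
    (is "outer_measure_of _ ?S \<le> _")
proof -
  let ?n = "CARD('n)" and ?D = "dilation_ratio TYPE('n)" and ?\<kappa> = "jn_rate TYPE('n)"
  define F where "F = {(a, r). r > 0 \<and> ennreal s * ennreal (r ^ ?n) \<le> (\<integral>\<^sup>+y\<in>cube a r. g y \<partial>lebesgue)}"
  obtain C where C: "countable C" "C \<subseteq> F"
    "\<And>a r. (a, r) \<in> F \<Longrightarrow> \<exists>(a', r')\<in>C. cube a r \<subseteq> dilated_cube a' r'"
    "ennreal s * (\<integral>\<^sup>+q. ennreal (snd q ^ ?n) \<partial>count_space C) \<le> (\<integral>\<^sup>+x. g x \<partial>lebesgue)"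
    using cube_covering[of g s F] g s fin by (auto simp: F_def)
  have D: "?D \<ge> 1" by (rule dilation_ratio_ge_1)
  have \<beta>: "\<beta> > 0" using p by (auto simp: bmo_bounded_def)
  define E where "E = (\<lambda>z. {x. \<exists>Q\<in>cubes. x \<in> Q \<and> Q \<subseteq> dilated_cube (fst z) (snd z) \<and> t < \<bar>p x - average p Q\<bar>})"
  define K where "K = (1 + ?D) * ?D * (\<beta> / ?\<kappa>)\<^sup>2"
  have K: "K \<ge> 0" using D by (simp add: K_def)
  have "?S \<subseteq> (\<Union>z\<in>C. E z)"
  proof
    fix x assume "x \<in> ?S"
    then obtain Q where Q: "Q \<in> cubes" "x \<in> Q" "ennreal s * emeasure lebesgue Q \<le> (\<integral>\<^sup>+y\<in>Q. g y \<partial>lebesgue)"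
      "t < \<bar>p x - average p Q\<bar>" by auto
    then obtain a r where ar: "r > 0" "Q = cube a r" by (auto simp: cubes_iff)
    then have "(a, r) \<in> F" using Q(3) by (auto simp: F_def emeasure_cube)
    then obtain u v where uv: "(u, v) \<in> C" "Q \<subseteq> dilated_cube u v" using C(3) ar by blast
    then have "x \<in> E (u, v)" using Q by (auto simp: E_def)
    then show "x \<in> (\<Union>z\<in>C. E z)" using uv by blast
  qed
  then have "outer_measure_of lebesgue ?S \<le> outer_measure_of lebesgue (\<Union>z\<in>C. E z)"
    by (rule outer_measure_of_mono)
  also have "\<dots> \<le> (\<integral>\<^sup>+z. outer_measure_of lebesgue (E z) \<partial>count_space C)"
    by (intro outer_measure_of_UN_le C) auto
  finally have "ennreal ((t / 2)\<^sup>2) * outer_measure_of lebesgue ?S \<le> ennreal ((t / 2)\<^sup>2) * (\<integral>\<^sup>+z. outer_measure_of lebesgue (E z) \<partial>count_space C)"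
    by (intro mult_left_mono) auto
  also have "\<dots> = (\<integral>\<^sup>+z. ennreal ((t / 2)\<^sup>2) * outer_measure_of lebesgue (E z) \<partial>count_space C)"
    by (intro nn_integral_cmult[symmetric]) simp
  also have "\<dots> \<le> (\<integral>\<^sup>+z. ennreal K * ennreal (snd z ^ ?n) \<partial>count_space C)"
  proof (intro nn_integral_mono)
    fix z assume "z \<in> space (count_space C)"
    then have z: "snd z > 0" using C(2) by (auto simp: F_def)
    have "ennreal ((t / 2)\<^sup>2) * outer_measure_of lebesgue (E z) \<le> ennreal ((1 + ?D) * (\<beta> / ?\<kappa>)\<^sup>2 * (10 * real ?n * snd z) ^ ?n)"
      using outer_measure_osc_level[OF p, of "10 * real ?n * snd z" "t / 2"] z t
      unfolding E_def dilated_cube_def by simp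
    also have "\<dots> = ennreal K * ennreal (snd z ^ ?n)"
      using K z by (simp add: ennreal_mult[symmetric] K_def power_mult_distrib mult_ac)
    finally show "ennreal ((t / 2)\<^sup>2) * outer_measure_of lebesgue (E z) \<le> ennreal K * ennreal (snd z ^ ?n)" .
  qed
  also have "\<dots> = ennreal K * (\<integral>\<^sup>+z. ennreal (snd z ^ ?n) \<partial>count_space C)"
    by (simp add: nn_integral_cmult)
  finally have *: "ennreal ((t / 2)\<^sup>2) * outer_measure_of lebesgue ?S \<le> ennreal K * (\<integral>\<^sup>+z. ennreal (snd z ^ ?n) \<partial>count_space C)" .
  have "outer_measure_of lebesgue ?S = ennreal (4 / t\<^sup>2) * (ennreal ((t / 2)\<^sup>2) * outer_measure_of lebesgue ?S)"
    using t by (simp add: mult.assoc[symmetric] ennreal_mult[symmetric] power_divide)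
  also have "\<dots> \<le> ennreal (4 / t\<^sup>2) * (ennreal K * (\<integral>\<^sup>+z. ennreal (snd z ^ ?n) \<partial>count_space C))"
    by (intro mult_left_mono *) simp
  also have "\<dots> = ennreal (4 / t\<^sup>2 * K / s) * (ennreal s * (\<integral>\<^sup>+z. ennreal (snd z ^ ?n) \<partial>count_space C))"
    using s K by (simp add: mult.assoc[symmetric] ennreal_mult[symmetric])
  also have "\<dots> \<le> ennreal (4 / t\<^sup>2 * K / s) * (\<integral>\<^sup>+x. g x \<partial>lebesgue)"
    by (intro mult_left_mono C) simp
  also have "4 / t\<^sup>2 * K / s = level_const TYPE('n) * (\<beta> / t)\<^sup>2 / s"
  proof -
    have "4 / t\<^sup>2 * ((1 + d) * d * (\<beta> / ?\<kappa>)\<^sup>2) / s = 4 * (1 + d) * d / ?\<kappa>\<^sup>2 * (\<beta> / t)\<^sup>2 / s" for d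
      by (simp add: power_divide mult_ac)
    then show ?thesis unfolding K_def level_const_def .
  qed
  finally show ?thesis .
qed

text \<open>Decomposing according to the dyadic size \<open>2 ^ (-k) \<tau> / \<beta>\<close> of the average of \<open>g\<close>, the
  \<open>k\<close>-th piece contributes \<open>O(2 ^ (-k))\<close>, because the measure of the covering cubes grows like
  \<open>2 ^ k\<close> while the second moment of the oscillation gains \<open>4 ^ (-k)\<close>.\<close>

lemma weak_type_osc_times_average:
  fixes p :: "real ^ 'n \<Rightarrow> real" and g :: "real ^ 'n \<Rightarrow> ennreal"
  assumes p: "bmo_bounded p \<beta>" and g: "g \<in> borel_measurable lebesgue"
    and fin: "(\<integral>\<^sup>+x. g x \<partial>lebesgue) < \<infinity>" and \<tau>: "\<tau> > 0"
  shows "outer_measure_of lebesgue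
           {x. \<exists>Q\<in>cubes. x \<in> Q \<and> ennreal \<tau> * emeasure lebesgue Q < ennreal \<bar>p x - average p Q\<bar> * (\<integral>\<^sup>+y\<in>Q. g y \<partial>lebesgue)}
         \<le> ennreal ((dilation_ratio TYPE('n) + 4 * level_const TYPE('n)) * (\<beta> / \<tau>)) * (\<integral>\<^sup>+x. g x \<partial>lebesgue)"
    (is "outer_measure_of _ ?S \<le> _ * ?I")
proof -
  let ?n = "CARD('n)" and ?D = "dilation_ratio TYPE('n)" and ?L = "level_const TYPE('n)"
  have \<beta>: "\<beta> > 0" using p by (auto simp: bmo_bounded_def)
  have D: "?D \<ge> 1" by (rule dilation_ratio_ge_1)
  define s where "s = (\<lambda>k::nat. \<tau> / \<beta> / 2 ^ k)"
  define A where "A = {x. \<exists>Q\<in>cubes. x \<in> Q \<and> ennreal (\<tau> / \<beta>) * emeasure lebesgue Q \<le> (\<integral>\<^sup>+y\<in>Q. g y \<partial>lebesgue)}"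
  \<comment> \<open>If the mean w of \<open>g\<close> satisfies s (k + 1) \<le> w < s k, then \<tau>
    < |p x - p_Q| w forces an oscillation above \<tau> / s k = \<beta> 2 ^ k. Means of at least s 0
    = \<tau> / \<beta> are left to \<open>A\<close>.\<close>
  define E where "E = (\<lambda>k. {x. \<exists>Q\<in>cubes. x \<in> Q \<and> ennreal (s (Suc k)) * emeasure lebesgue Q \<le> (\<integral>\<^sup>+y\<in>Q. g y \<partial>lebesgue)
                         \<and> \<beta> * 2 ^ k < \<bar>p x - average p Q\<bar>})"
  have "?S \<subseteq> A \<union> (\<Union>k. E k)"
  proof
    fix x assume "x \<in> ?S"
    then obtain Q where Q: "Q \<in> cubes" "x \<in> Q"
      "ennreal \<tau> * emeasure lebesgue Q < ennreal \<bar>p x - average p Q\<bar> * (\<integral>\<^sup>+y\<in>Q. g y \<partial>lebesgue)" by auto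
    then obtain a r where ar: "r > 0" "Q = cube a r" by (auto simp: cubes_iff)
    define w where "w = enn2real (\<integral>\<^sup>+y\<in>Q. g y \<partial>lebesgue) / r ^ ?n"
    have "(\<integral>\<^sup>+y\<in>Q. g y \<partial>lebesgue) \<le> ?I" by (intro nn_integral_mono) (auto simp: indicator_def)
    then have w: "(\<integral>\<^sup>+y\<in>Q. g y \<partial>lebesgue) = ennreal (w * r ^ ?n)" "w \<ge> 0"
      using fin ar by (auto simp: w_def)
    have eQ: "emeasure lebesgue Q = ennreal (r ^ ?n)" using ar by (simp add: emeasure_cube)
    have "ennreal (\<tau> * r ^ ?n) < ennreal (\<bar>p x - average p Q\<bar> * w * r ^ ?n)"
      using Q(3) w \<tau> ar unfolding eQ by (simp add: ennreal_mult' mult.assoc)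
    then have lt: "\<tau> < \<bar>p x - average p Q\<bar> * w"
      using \<tau> ar by (subst (asm) ennreal_less_iff) auto
    then have wpos: "w > 0" using w(2) \<tau> by (cases "w = 0") auto
    have iff: "ennreal c * emeasure lebesgue Q \<le> (\<integral>\<^sup>+y\<in>Q. g y \<partial>lebesgue) \<longleftrightarrow> c \<le> w" if "c > 0" for c
      using that ar w wpos unfolding eQ w(1) by (simp add: ennreal_mult[symmetric])
    show "x \<in> A \<union> (\<Union>k. E k)"
    proof (cases "\<tau> / \<beta> \<le> w")
      case True
      then show ?thesis using Q iff[of "\<tau> / \<beta>"] \<tau> \<beta> by (auto simp: A_def)
    next
      case False
      obtain m0 where "\<tau> / \<beta> / w < 2 ^ m0" using real_arch_pow[of 2 "\<tau> / \<beta> / w"] by auto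
      then have m0: "s m0 \<le> w" using wpos \<beta> by (simp add: s_def field_simps)
      define m where "m = (LEAST m. s m \<le> w)"
      have m: "s m \<le> w" unfolding m_def by (rule LeastI[of "\<lambda>m. s m \<le> w"]) fact
      then obtain k where k: "m = Suc k" using False by (cases m) (auto simp: s_def)
      have "w < s k" using not_less_Least[of k "\<lambda>m. s m \<le> w"] k unfolding m_def by auto
      have "\<tau> < \<bar>p x - average p Q\<bar> * w" by (rule lt)
      also have "\<dots> \<le> \<bar>p x - average p Q\<bar> * s k"
        using \<open>w < s k\<close> by (intro mult_left_mono) auto
      finally have "\<beta> * 2 ^ k < \<bar>p x - average p Q\<bar>"
        using \<tau> \<beta> by (simp add: s_def field_simps)
      moreover have "s (Suc k) > 0" using \<tau> \<beta> by (simp add: s_def)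
      ultimately have "x \<in> E k" using Q m k iff[of "s (Suc k)"] by (auto simp: E_def)
      then show ?thesis by blast
    qed
  qed
  then have "outer_measure_of lebesgue ?S \<le> outer_measure_of lebesgue (A \<union> (\<Union>k. E k))"
    by (rule outer_measure_of_mono)
  also have "\<dots> \<le> outer_measure_of lebesgue A + outer_measure_of lebesgue (\<Union>k. E k)"
    by (intro outer_measure_of_Un_le) auto
  also have "\<dots> \<le> outer_measure_of lebesgue A + (\<integral>\<^sup>+k. outer_measure_of lebesgue (E k) \<partial>count_space UNIV)"
    by (intro add_left_mono outer_measure_of_UN_le) auto
  also have "(\<integral>\<^sup>+k. outer_measure_of lebesgue (E k) \<partial>count_space UNIV)
      \<le> (\<integral>\<^sup>+k. ennreal (2 * ?L * (\<beta> / \<tau>) * (1 / 2) ^ k) * ?I \<partial>count_space UNIV)"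
  proof (intro nn_integral_mono)
    fix k
    have "outer_measure_of lebesgue (E k) \<le> ennreal (?L * (\<beta> / (\<beta> * 2 ^ k))\<^sup>2 / s (Suc k)) * ?I"
      unfolding E_def using \<beta> \<tau> by (intro outer_measure_average_osc_level p g fin) (auto simp: s_def)
    \<comment> \<open>The squared ratio gives 4 ^ (-k) and 1 / s (k + 1) gives 2 ^ (k + 1) \<beta> /
      \<tau>; summing the geometric series turns the 2 into the 4 of the final constant.\<close>
    also have "?L * (\<beta> / (\<beta> * 2 ^ k))\<^sup>2 / s (Suc k) = 2 * ?L * (\<beta> / \<tau>) * (1 / 2) ^ k"
      using \<beta> by (simp add: s_def power2_eq_square power_divide mult_ac)
    finally show "outer_measure_of lebesgue (E k) \<le> ennreal (2 * ?L * (\<beta> / \<tau>) * (1 / 2) ^ k) * ?I" .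
  qed
  also have "\<dots> = (\<Sum>k. ennreal (2 * ?L * (\<beta> / \<tau>) * (1 / 2) ^ k)) * ?I"
    by (simp add: nn_integral_multc nn_integral_count_space_nat)
  also have "(\<Sum>k. ennreal (2 * ?L * (\<beta> / \<tau>) * (1 / 2) ^ k)) = ennreal (4 * ?L * (\<beta> / \<tau>))"
  proof (rule suminf_ennreal_eq)
    have "(\<lambda>k. (2 * ?L * (\<beta> / \<tau>)) * (1 / 2) ^ k) sums ((2 * ?L * (\<beta> / \<tau>)) * (1 / (1 - 1 / 2)))"
      by (intro sums_mult geometric_sums) auto
    then show "(\<lambda>k. 2 * ?L * (\<beta> / \<tau>) * (1 / 2) ^ k) sums (4 * ?L * (\<beta> / \<tau>))" by (simp add: mult_ac)
  qed (use \<beta> \<tau> level_const_nonneg[where 'n='n] in auto)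
  also have "outer_measure_of lebesgue A \<le> ennreal (?D * (\<beta> / \<tau>)) * ?I"
  proof -
    have "outer_measure_of lebesgue A = ennreal (\<beta> / \<tau>) * (ennreal (\<tau> / \<beta>) * outer_measure_of lebesgue A)"
      using \<beta> \<tau> by (simp add: mult.assoc[symmetric] ennreal_mult[symmetric])
    also have "\<dots> \<le> ennreal (\<beta> / \<tau>) * (ennreal ?D * ?I)"
      unfolding A_def using \<beta> \<tau> by (intro mult_left_mono maximal_weak_type g) auto
    also have "\<dots> = ennreal (\<beta> / \<tau> * ?D) * ?I"
      unfolding mult.assoc[symmetric] using \<beta> \<tau> by (subst ennreal_mult) auto
    also have "\<beta> / \<tau> * ?D = ?D * (\<beta> / \<tau>)" by (rule mult.commute)
    finally show ?thesis .
  qed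
  also have "ennreal (?D * (\<beta> / \<tau>)) * ?I + ennreal (4 * ?L * (\<beta> / \<tau>)) * ?I = ennreal ((?D + 4 * ?L) * (\<beta> / \<tau>)) * ?I"
  proof -
    have "(?D + 4 * ?L) * (\<beta> / \<tau>) = ?D * (\<beta> / \<tau>) + 4 * ?L * (\<beta> / \<tau>)" by (rule distrib_right)
    then have "ennreal ((?D + 4 * ?L) * (\<beta> / \<tau>)) = ennreal (?D * (\<beta> / \<tau>)) + ennreal (4 * ?L * (\<beta> / \<tau>))"
      using \<beta> \<tau> D level_const_nonneg[where 'n='n] by (simp only:) (intro ennreal_plus mult_nonneg_nonneg, auto)
    then show ?thesis by (simp only: distrib_right)
  qed
  finally show ?thesis by (simp add: add_mono)
qed

text \<open>For t > 1 this is t times the tangent bound e ^ v \<ge> 1 + v at v = u - ln t, with -t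
  weakened to -1; for t \<le> 1 it reduces to u \<le> e ^ u - 1.\<close>

lemma young_exp_log:
  fixes u t :: real
  assumes "u \<ge> 0" "t \<ge> 0"
  shows "u * t \<le> (exp u - 1) + t * max (ln t) 0"
proof (cases "t \<le> 1")
  case True
  have "u * t \<le> u * 1" using assms True by (intro mult_left_mono) auto
  also have "\<dots> \<le> exp u - 1" using exp_ge_add_one_self[of u] by linarith
  moreover have "0 \<le> t * max (ln t) 0" using assms by (intro mult_nonneg_nonneg) auto
  ultimately show ?thesis by linarith
next
  case False
  have "t * (1 + (u - ln t)) \<le> t * exp (u - ln t)"
    using False by (intro mult_left_mono exp_ge_add_one_self) auto
  also have "\<dots> = exp u" using False by (simp add: exp_diff)
  finally have "u * t \<le> exp u - t + t * ln t" by (simp add: algebra_simps)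
  then show ?thesis using False by (simp add: max_def)
qed

text \<open>Young's inequality is used with u = \<open>jn_rate\<close> / \<beta> times the
  oscillation and t = \<beta> |f| / (\<open>jn_rate\<close> * \<tau>), scaled so that u t is the
  integrand divided by \<tau>.\<close>

lemma weak_type_average_of_osc:
  fixes p f :: "real ^ 'n \<Rightarrow> real"
  assumes p: "bmo_bounded p \<beta>" and f [measurable]: "f \<in> borel_measurable lebesgue" and \<tau>: "\<tau> > 0"
  shows "outer_measure_of lebesgue
           {x. \<exists>Q\<in>cubes. x \<in> Q \<and> ennreal \<tau> * emeasure lebesgue Q \<le> (\<integral>\<^sup>+y\<in>Q. ennreal (\<bar>p y - average p Q\<bar> * \<bar>f y\<bar>) \<partial>lebesgue)}
         \<le> ennreal (2 * dilation_ratio TYPE('n)) *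
           (\<integral>\<^sup>+y. ennreal (\<beta> * \<bar>f y\<bar> / (jn_rate TYPE('n) * \<tau>) * max (ln (\<beta> * \<bar>f y\<bar> / (jn_rate TYPE('n) * \<tau>))) 0) \<partial>lebesgue)"
    (is "outer_measure_of _ ?S \<le> _")
proof -
  let ?D = "dilation_ratio TYPE('n)" and ?\<kappa> = "jn_rate TYPE('n)"
  define t where "t = (\<lambda>y. \<beta> * \<bar>f y\<bar> / (?\<kappa> * \<tau>))"
  define g where "g = (\<lambda>y. ennreal (t y * max (ln (t y)) 0))"
  have \<beta>: "\<beta> > 0" and li: "locally_integrable p" using p by (auto simp: bmo_bounded_def)
  have pm [measurable]: "p \<in> borel_measurable lebesgue" by (rule locally_integrable_measurable[OF li])
  have \<kappa>: "?\<kappa> > 0" by (rule jn_rate_pos)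
  have g [measurable]: "g \<in> borel_measurable lebesgue" unfolding g_def t_def by measurable
  have half: "ennreal (1 / 2) + ennreal (1 / 2) = 1" by (subst ennreal_plus[symmetric]) auto
  have t0: "t y \<ge> 0" for y using \<beta> \<kappa> \<tau> by (simp add: t_def)
  have "?S \<subseteq> {x. \<exists>Q\<in>cubes. x \<in> Q \<and> ennreal (1 / 2) * emeasure lebesgue Q \<le> (\<integral>\<^sup>+y\<in>Q. g y \<partial>lebesgue)}"
  proof
    fix x assume "x \<in> ?S"
    then obtain Q where Q: "Q \<in> cubes" "x \<in> Q"
      "ennreal \<tau> * emeasure lebesgue Q \<le> (\<integral>\<^sup>+y\<in>Q. ennreal (\<bar>p y - average p Q\<bar> * \<bar>f y\<bar>) \<partial>lebesgue)" by auto
    then obtain a r where ar: "r > 0" "Q = cube a r" by (auto simp: cubes_iff)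
    let ?u = "\<lambda>y. ?\<kappa> / \<beta> * \<bar>p y - average p Q\<bar>"
    have eQ: "emeasure lebesgue Q = ennreal (r ^ CARD('n))" using ar by (simp add: emeasure_cube)
    have "emeasure lebesgue Q = ennreal (1 / \<tau>) * (ennreal \<tau> * emeasure lebesgue Q)"
      using \<tau> by (simp add: mult.assoc[symmetric] ennreal_mult[symmetric])
    also have "\<dots> \<le> ennreal (1 / \<tau>) * (\<integral>\<^sup>+y\<in>Q. ennreal (\<bar>p y - average p Q\<bar> * \<bar>f y\<bar>) \<partial>lebesgue)"
      by (intro mult_left_mono Q) simp
    also have "\<dots> = (\<integral>\<^sup>+y. ennreal (1 / \<tau>) * (ennreal (\<bar>p y - average p Q\<bar> * \<bar>f y\<bar>) * indicator Q y) \<partial>lebesgue)"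
      unfolding ar(2) by (intro nn_integral_cmult[symmetric]) measurable
    also have "\<dots> \<le> (\<integral>\<^sup>+y. ennreal (exp (?u y) - 1) * indicator Q y + g y * indicator Q y \<partial>lebesgue)"
    proof (intro nn_integral_mono)
      fix y
      have "1 / \<tau> * (\<bar>p y - average p Q\<bar> * \<bar>f y\<bar>) = ?u y * t y"
        using \<beta> \<kappa> by (simp add: t_def)
      also have "\<dots> \<le> (exp (?u y) - 1) + t y * max (ln (t y)) 0"
        using \<beta> \<kappa> t0 by (intro young_exp_log) auto
      finally have "ennreal (1 / \<tau> * (\<bar>p y - average p Q\<bar> * \<bar>f y\<bar>)) \<le> ennreal ((exp (?u y) - 1) + t y * max (ln (t y)) 0)"
        by (rule ennreal_leI)
      also have "\<dots> = ennreal (exp (?u y) - 1) + g y"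
        unfolding g_def using t0 \<beta> \<kappa> by (intro ennreal_plus) (auto intro!: mult_nonneg_nonneg)
      finally show "ennreal (1 / \<tau>) * (ennreal (\<bar>p y - average p Q\<bar> * \<bar>f y\<bar>) * indicator Q y)
          \<le> ennreal (exp (?u y) - 1) * indicator Q y + g y * indicator Q y"
        using \<tau> by (auto simp: indicator_def ennreal_mult'[symmetric])
    qed
    also have "\<dots> = (\<integral>\<^sup>+y\<in>Q. ennreal (exp (?u y) - 1) \<partial>lebesgue) + (\<integral>\<^sup>+y\<in>Q. g y \<partial>lebesgue)"
      unfolding ar(2) by (intro nn_integral_add) measurable
    \<comment> \<open>The exponential term uses up only half of |Q|, so the mean of \<open>g\<close>
      over Q is at least 1 / 2; this is the origin of the factor 2 in the result.\<close>
    also have "\<dots> \<le> ennreal (1 / 2) * emeasure lebesgue Q + (\<integral>\<^sup>+y\<in>Q. g y \<partial>lebesgue)"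
    proof (intro add_right_mono)
      have "ennreal (1 / 2) * emeasure lebesgue Q = ennreal (1 / 2 * r ^ CARD('n))"
        unfolding eQ using ar by (intro ennreal_mult[symmetric]) auto
      then show "(\<integral>\<^sup>+y\<in>Q. ennreal (exp (?u y) - 1) \<partial>lebesgue) \<le> ennreal (1 / 2) * emeasure lebesgue Q"
        using john_nirenberg[OF p ar(1), of a] unfolding ar(2) by (simp only:)
    qed
    finally have "emeasure lebesgue Q \<le> ennreal (1 / 2) * emeasure lebesgue Q + (\<integral>\<^sup>+y\<in>Q. g y \<partial>lebesgue)" .
    then have "ennreal (1 / 2) * emeasure lebesgue Q + ennreal (1 / 2) * emeasure lebesgue Q
        \<le> ennreal (1 / 2) * emeasure lebesgue Q + (\<integral>\<^sup>+y\<in>Q. g y \<partial>lebesgue)"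
      by (simp only: half distrib_right[symmetric] mult_1)
    then have "ennreal (1 / 2) * emeasure lebesgue Q \<le> (\<integral>\<^sup>+y\<in>Q. g y \<partial>lebesgue)"
      using eQ by (auto simp: ennreal_add_left_cancel_le ennreal_mult_eq_top_iff)
    then show "x \<in> {x. \<exists>Q\<in>cubes. x \<in> Q \<and> ennreal (1 / 2) * emeasure lebesgue Q \<le> (\<integral>\<^sup>+y\<in>Q. g y \<partial>lebesgue)}"
      using Q by blast
  qed
  then have "outer_measure_of lebesgue ?S \<le> outer_measure_of lebesgue {x. \<exists>Q\<in>cubes. x \<in> Q \<and> ennreal (1 / 2) * emeasure lebesgue Q \<le> (\<integral>\<^sup>+y\<in>Q. g y \<partial>lebesgue)}"
    (is "_ \<le> outer_measure_of _ ?T") by (rule outer_measure_of_mono)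
  also have "\<dots> = ennreal 2 * (ennreal (1 / 2) * outer_measure_of lebesgue ?T)"
    by (simp add: mult.assoc[symmetric] ennreal_mult[symmetric] del: ennreal_numeral ennreal_half)
  also have "\<dots> \<le> ennreal 2 * (ennreal ?D * (\<integral>\<^sup>+y. g y \<partial>lebesgue))"
    by (intro mult_left_mono maximal_weak_type g) auto
  also have "\<dots> = ennreal (2 * ?D) * (\<integral>\<^sup>+y. g y \<partial>lebesgue)"
    by (subst ennreal_mult) (auto simp: mult.assoc)
  finally show ?thesis unfolding g_def t_def .
qed

section \<open>The commutator\<close>

lemma ennreal_divide_le_iff:
  assumes "e > 0"
  shows "a / ennreal e \<le> c \<longleftrightarrow> a \<le> c * ennreal e"
proof -
  have eq: "a / ennreal e = a * ennreal (1 / e)"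
    using assms by (simp add: divide_ennreal_def inverse_ennreal inverse_eq_divide)
  have cancel: "z * ennreal (1 / e) * ennreal e = z" "z * ennreal e * ennreal (1 / e) = z" for z
    using assms by (auto simp: mult.assoc ennreal_mult[symmetric])
  show ?thesis
    unfolding eq using mult_right_mono[of "a * ennreal (1 / e)" c "ennreal e"]
      mult_right_mono[of a "c * ennreal e" "ennreal (1 / e)"] by (auto simp: cancel)
qed

lemma divide_emeasure_cube_le_iff:
  assumes "Q \<in> cubes"
  shows "a / emeasure lebesgue Q \<le> c \<longleftrightarrow> a \<le> c * emeasure lebesgue Q"
proof -
  obtain u r where "r > 0" "Q = cube u r" using assms by (auto simp: cubes_iff)
  then have "emeasure lebesgue Q = ennreal (r ^ CARD('a))" "r ^ CARD('a) > 0" by (auto simp: emeasure_cube)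
  then show ?thesis by (simp only: ennreal_divide_le_iff)
qed

lemma hl_maximal_le_iff:
  "hl_maximal f x \<le> c \<longleftrightarrow>
     (\<forall>Q\<in>cubes. x \<in> Q \<longrightarrow> (\<integral>\<^sup>+y\<in>Q. ennreal \<bar>f y\<bar> \<partial>lebesgue) \<le> c * emeasure lebesgue Q)"
  unfolding hl_maximal_def SUP_le_iff using divide_emeasure_cube_le_iff by auto

lemma bmo_boundedI:
  assumes "locally_integrable p" "\<beta> > 0" "bmo_norm p \<le> ennreal \<beta>"
  shows "bmo_bounded p \<beta>"
  using assms divide_emeasure_cube_le_iff unfolding bmo_bounded_def bmo_norm_def SUP_le_iff by blast

text \<open>Sublinearity of the maximal operator at a single point. As x is fixed, \<open>c\<close>
  may depend on it, so that |b x| can enter below; real bounds keep infinite values out.\<close>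

lemma hl_maximal_mult_le:
  fixes f g h k :: "real ^ 'n \<Rightarrow> real"
  assumes [measurable]: "f \<in> borel_measurable lebesgue" "h \<in> borel_measurable lebesgue" "k \<in> borel_measurable lebesgue"
    and le: "AE y in lebesgue. \<bar>g y\<bar> \<le> \<bar>h y\<bar> + c * \<bar>f y\<bar> + \<bar>k y\<bar>"
    and c: "c \<ge> 0" and nonneg: "H \<ge> 0" "m \<ge> 0" "e \<ge> 0"
    and H: "hl_maximal h x \<le> ennreal H" and m: "hl_maximal f x \<le> ennreal m" and e: "hl_maximal k x \<le> ennreal e"
  shows "hl_maximal g x \<le> ennreal (H + c * m + e)"
  unfolding hl_maximal_le_iff
proof (intro ballI impI)
  fix Q :: "(real ^ 'n) set"
  assume Q: "Q \<in> cubes" "x \<in> Q"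
  then obtain a r where ar: "r > 0" "Q = cube a r" by (auto simp: cubes_iff)
  have [measurable]: "Q \<in> sets lebesgue" using ar by simp
  have "(\<integral>\<^sup>+y\<in>Q. ennreal \<bar>g y\<bar> \<partial>lebesgue)
      \<le> (\<integral>\<^sup>+y. ennreal \<bar>h y\<bar> * indicator Q y + ennreal c * (ennreal \<bar>f y\<bar> * indicator Q y) + ennreal \<bar>k y\<bar> * indicator Q y \<partial>lebesgue)"
  proof (intro nn_integral_mono_AE)
    show "AE y in lebesgue. ennreal \<bar>g y\<bar> * indicator Q y
        \<le> ennreal \<bar>h y\<bar> * indicator Q y + ennreal c * (ennreal \<bar>f y\<bar> * indicator Q y) + ennreal \<bar>k y\<bar> * indicator Q y"
      using le
    proof eventually_elim
      case (elim y)
      then have "ennreal \<bar>g y\<bar> \<le> ennreal (\<bar>h y\<bar> + c * \<bar>f y\<bar> + \<bar>k y\<bar>)" by (rule ennreal_leI)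
      also have "\<dots> = ennreal \<bar>h y\<bar> + ennreal c * ennreal \<bar>f y\<bar> + ennreal \<bar>k y\<bar>"
        using c by (simp add: ennreal_plus ennreal_mult)
      finally show ?case by (auto simp: indicator_def)
    qed
  qed
  also have "\<dots> = (\<integral>\<^sup>+y\<in>Q. ennreal \<bar>h y\<bar> \<partial>lebesgue) + ennreal c * (\<integral>\<^sup>+y\<in>Q. ennreal \<bar>f y\<bar> \<partial>lebesgue)
      + (\<integral>\<^sup>+y\<in>Q. ennreal \<bar>k y\<bar> \<partial>lebesgue)"
    by (simp add: nn_integral_add nn_integral_cmult)
  also have "\<dots> \<le> ennreal H * emeasure lebesgue Q + ennreal c * (ennreal m * emeasure lebesgue Q) + ennreal e * emeasure lebesgue Q"
    using H m e Q unfolding hl_maximal_le_iff by (intro add_mono mult_left_mono) auto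
  also have "\<dots> = ennreal (H + c * m + e) * emeasure lebesgue Q"
    using c nonneg by (simp add: ennreal_plus ennreal_mult distrib_right mult.assoc)
  finally show "(\<integral>\<^sup>+y\<in>Q. ennreal \<bar>g y\<bar> \<partial>lebesgue) \<le> ennreal (H + c * m + e) * emeasure lebesgue Q" .
qed

text \<open>The bounds make Mf(x) and M(bf)(x) finite, so the \<open>ereal\<close> difference is an
  ordinary one. They are matched so that 3 \<beta> Mf(x) \<le> l / 2, leaving the other l / 2 to the
  oscillation term.\<close>

lemma abs_hl_commutator_le:
  fixes b f :: "real ^ 'n \<Rightarrow> real"
  assumes b [measurable]: "b \<in> borel_measurable lebesgue" and f [measurable]: "f \<in> borel_measurable lebesgue"
    and neg: "AE y in lebesgue. neg_part b y \<le> \<beta>" and x: "neg_part b x \<le> \<beta>"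
    and \<beta>: "\<beta> > 0" and l: "l > 0"
    and max: "hl_maximal f x \<le> ennreal (l / (6 * \<beta>))"
    and osc: "hl_maximal (\<lambda>y. (pos_part b x - pos_part b y) * f y) x \<le> ennreal (l / 2)"
  shows "\<bar>hl_commutator b f x\<bar> \<le> ereal l"
proof -
  let ?k = "\<lambda>y. (pos_part b x - pos_part b y) * f y"
  have [measurable]: "?k \<in> borel_measurable lebesgue" unfolding pos_part_def by measurable
  define m where "m = enn2real (hl_maximal f x)"
  have "hl_maximal f x < \<infinity>" using max by (auto intro: order.strict_trans1)
  then have m: "hl_maximal f x = ennreal m" "m \<ge> 0" by (auto simp: m_def)
  have ml: "m \<le> l / (6 * \<beta>)" using max \<beta> l unfolding m(1) by (subst (asm) ennreal_le_iff) auto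
  then have \<beta>m: "\<beta> * m \<le> l / 6" using \<beta> by (simp add: field_simps)
  have ae1: "AE y in lebesgue. \<bar>b y * f y\<bar> \<le> \<bar>0\<bar> + (\<bar>b x\<bar> + \<beta>) * \<bar>f y\<bar> + \<bar>?k y\<bar>"
    using neg
  proof eventually_elim
    case (elim y)
    then have "\<bar>b y\<bar> \<le> (\<bar>b x\<bar> + \<beta>) + \<bar>pos_part b x - pos_part b y\<bar>"
      using \<beta> by (auto simp: pos_part_def neg_part_def)
    from mult_right_mono[OF this abs_ge_zero[of "f y"]] show ?case
      by (simp add: abs_mult distrib_right)
  qed
  have zero: "hl_maximal (\<lambda>_. 0) x \<le> ennreal 0" unfolding hl_maximal_le_iff by simp
  have upper: "hl_maximal (\<lambda>y. b y * f y) x \<le> ennreal (0 + (\<bar>b x\<bar> + \<beta>) * m + l / 2)"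
    using \<beta> l m osc by (intro hl_maximal_mult_le[OF _ _ _ ae1 _ _ _ _ zero]) auto
  define M where "M = enn2real (hl_maximal (\<lambda>y. b y * f y) x)"
  have "hl_maximal (\<lambda>y. b y * f y) x < \<infinity>" using upper by (auto intro: order.strict_trans1)
  then have M: "hl_maximal (\<lambda>y. b y * f y) x = ennreal M" "M \<ge> 0" by (auto simp: M_def)
  have Mu: "M \<le> (\<bar>b x\<bar> + \<beta>) * m + l / 2"
    using upper \<beta> l m unfolding M(1) by (subst (asm) ennreal_le_iff) auto
  have ae2: "AE y in lebesgue. \<bar>b x * f y\<bar> \<le> \<bar>b y * f y\<bar> + \<beta> * \<bar>f y\<bar> + \<bar>?k y\<bar>"
  proof (intro AE_I2)
    fix y
    have "\<bar>b x\<bar> \<le> \<bar>b y\<bar> + \<beta> + \<bar>pos_part b x - pos_part b y\<bar>"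
      using x \<beta> by (auto simp: pos_part_def neg_part_def)
    from mult_right_mono[OF this abs_ge_zero[of "f y"]]
    show "\<bar>b x * f y\<bar> \<le> \<bar>b y * f y\<bar> + \<beta> * \<bar>f y\<bar> + \<bar>?k y\<bar>"
      by (simp add: abs_mult distrib_right)
  qed
  have lower: "hl_maximal (\<lambda>y. b x * f y) x \<le> ennreal (M + \<beta> * m + l / 2)"
    using \<beta> l m M osc by (intro hl_maximal_mult_le[OF _ _ _ ae2]) auto
  \<comment> \<open>The maximal operator is homogeneous; the bound for b x * f is divided by |b x|
    to recover Mf(x), hence the separate case b x = 0.\<close>
  have bm: "\<bar>b x\<bar> * m \<le> M + \<beta> * m + l / 2"
  proof (cases "b x = 0")
    case True
    then show ?thesis using M m \<beta> l by simp
  next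
    case False
    let ?c = "M + \<beta> * m + l / 2"
    have c: "?c \<ge> 0" using M m \<beta> l by simp
    have "hl_maximal f x \<le> ennreal (?c / \<bar>b x\<bar>)"
      unfolding hl_maximal_le_iff
    proof (intro ballI impI)
      fix Q :: "(real ^ 'n) set"
      assume Q: "Q \<in> cubes" "x \<in> Q"
      then have [measurable]: "Q \<in> sets lebesgue" by (auto simp: cubes_iff)
      have "(\<integral>\<^sup>+y\<in>Q. ennreal \<bar>f y\<bar> \<partial>lebesgue) = (\<integral>\<^sup>+y. ennreal (1 / \<bar>b x\<bar>) * (ennreal \<bar>b x * f y\<bar> * indicator Q y) \<partial>lebesgue)"
        using False by (intro nn_integral_cong) (auto simp: indicator_def ennreal_mult'[symmetric] abs_mult)
      also have "\<dots> = ennreal (1 / \<bar>b x\<bar>) * (\<integral>\<^sup>+y\<in>Q. ennreal \<bar>b x * f y\<bar> \<partial>lebesgue)"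
        by (intro nn_integral_cmult) measurable
      also have "\<dots> \<le> ennreal (1 / \<bar>b x\<bar>) * (ennreal ?c * emeasure lebesgue Q)"
        using lower Q unfolding hl_maximal_le_iff by (intro mult_left_mono) auto
      also have "\<dots> = ennreal (?c / \<bar>b x\<bar>) * emeasure lebesgue Q"
        using c by (simp add: mult.assoc[symmetric] ennreal_mult'[symmetric] del: ennreal_plus)
      finally show "(\<integral>\<^sup>+y\<in>Q. ennreal \<bar>f y\<bar> \<partial>lebesgue) \<le> ennreal (?c / \<bar>b x\<bar>) * emeasure lebesgue Q" .
    qed
    then have "m \<le> ?c / \<bar>b x\<bar>" unfolding m(1) using c by (subst (asm) ennreal_le_iff) auto
    then show ?thesis using False by (simp add: field_simps)
  qed
  have comm: "hl_commutator b f x = ereal (M - b x * m)"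
    unfolding hl_commutator_def M(1) m(1) using M(2) m(2) by simp
  \<comment> \<open>The maximal functions only see |b|; returning to the signed value b x costs
    twice the negative part.\<close>
  have "\<bar>b x\<bar> \<le> b x + 2 * \<beta>" using x \<beta> by (auto simp: neg_part_def abs_real_def)
  from mult_right_mono[OF this m(2)] have "\<bar>b x\<bar> * m \<le> b x * m + 2 * (\<beta> * m)"
    by (simp add: algebra_simps)
  moreover have "b x * m \<le> \<bar>b x\<bar> * m" using m by (intro mult_right_mono) auto
  moreover have "(\<bar>b x\<bar> + \<beta>) * m = \<bar>b x\<bar> * m + \<beta> * m" by (rule distrib_right)
  ultimately have "\<bar>M - b x * m\<bar> \<le> l" using Mu bm \<beta>m l by linarith
  then show ?thesis by (simp add: comm)
qed

section \<open>Submultiplicativity of t (1 + log^+ t)\<close>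

definition lnp :: "real \<Rightarrow> real" where "lnp t = max (ln t) 0"

lemma lnp_nonneg: "lnp t \<ge> 0" by (simp add: lnp_def)

lemma lnp_mult_le:
  assumes "s \<ge> 0" "t \<ge> 0"
  shows "lnp (s * t) \<le> lnp s + lnp t"
proof (cases "s = 0 \<or> t = 0")
  case False
  then have "ln (s * t) = ln s + ln t" using assms by (simp add: ln_mult)
  then show ?thesis by (simp add: lnp_def max_def)
qed (auto simp: lnp_def)

lemma one_plus_lnp_mult_le:
  assumes "s \<ge> 0" "t \<ge> 0"
  shows "1 + lnp (s * t) \<le> (1 + lnp s) * (1 + lnp t)"
  using lnp_mult_le[OF assms] mult_nonneg_nonneg[OF lnp_nonneg[of s] lnp_nonneg[of t]]
  by (simp add: algebra_simps)

definition LlogL_young :: "real \<Rightarrow> real" where "LlogL_young t = t * (1 + lnp t)"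

lemma LlogL_young_nonneg: "t \<ge> 0 \<Longrightarrow> LlogL_young t \<ge> 0"
  using lnp_nonneg[of t] by (simp add: LlogL_young_def)

lemma LlogL_young_ge: "t \<ge> 0 \<Longrightarrow> t \<le> LlogL_young t"
  using lnp_nonneg[of t] by (simp add: LlogL_young_def distrib_left)

text \<open>From log^+ (s t) \<le> log^+ s + log^+ t and 1 + a + b \<le> (1 + a) (1 + b). This
  splits \<beta> |f| / l into its factors and so produces C0 (1 + log^+ C0).\<close>

lemma LlogL_young_mult_le:
  assumes "s \<ge> 0" "t \<ge> 0"
  shows "LlogL_young (s * t) \<le> LlogL_young s * LlogL_young t"
proof -
  have "(s * t) * (1 + lnp (s * t)) \<le> (s * t) * ((1 + lnp s) * (1 + lnp t))"
    using assms by (intro mult_left_mono one_plus_lnp_mult_le) auto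
  then show ?thesis by (simp add: LlogL_young_def mult_ac)
qed

lemma LlogL_young_measurable [measurable]: "LlogL_young \<in> borel_measurable borel"
  unfolding LlogL_young_def lnp_def by measurable

lemma ennreal_LlogL_young: "t \<ge> 0 \<Longrightarrow> ennreal t * (1 + log_plus (ennreal t)) = ennreal (LlogL_young t)"
  using lnp_nonneg[of t]
  by (simp add: LlogL_young_def log_plus_ennreal lnp_def[symmetric] ennreal_mult)

text \<open>One summand for each of \<open>A\<close>, \<open>S1\<close> and \<open>S2\<close> in
  \<open>hl_commutator_weak_type\<close>: 6 reflects the level l / (6 \<beta>), the first 4 and the
  4 in 4 / \<open>jn_rate\<close> reflect the level l / 4.\<close>

definition commutator_const :: "'n itself \<Rightarrow> real" where
  "commutator_const n = 6 * dilation_ratio n + 4 * (dilation_ratio n + 4 * level_const n)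
     + 2 * dilation_ratio n * LlogL_young (4 / jn_rate n)"

lemma commutator_const_pos: "commutator_const TYPE('n::finite) > 0"
proof -
  have "dilation_ratio TYPE('n) \<ge> 1" "level_const TYPE('n) \<ge> 0" "LlogL_young (4 / jn_rate TYPE('n)) \<ge> 0"
    using dilation_ratio_ge_1 level_const_nonneg jn_rate_pos[where 'n='n] by (auto intro: LlogL_young_nonneg)
  then show ?thesis
    unfolding commutator_const_def by (smt (verit) mult_nonneg_nonneg)
qed

text \<open>An arbitrary admissible \<beta> stands in for C0, so that it can later tend to 0. Off
  the null set \<open>N\<close> and the sets \<open>A\<close>, \<open>S1\<close>, \<open>S2\<close>
  of the proof, \<open>abs_hl_commutator_le\<close> applies.\<close>

lemma hl_commutator_weak_type:
  fixes b f :: "real ^ 'n \<Rightarrow> real"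
  assumes b [measurable]: "b \<in> borel_measurable lebesgue" and f [measurable]: "f \<in> borel_measurable lebesgue"
    and p: "bmo_bounded (pos_part b) \<beta>" and neg: "AE y in lebesgue. neg_part b y \<le> \<beta>"
    and fin: "(\<integral>\<^sup>+y. ennreal \<bar>f y\<bar> \<partial>lebesgue) < \<infinity>" and l: "l > 0"
  shows "outer_measure_of lebesgue {x. ereal l < \<bar>hl_commutator b f x\<bar>}
    \<le> ennreal (commutator_const TYPE('n) * LlogL_young \<beta>) * (\<integral>\<^sup>+y. ennreal (LlogL_young (\<bar>f y\<bar> / l)) \<partial>lebesgue)"
    (is "outer_measure_of _ ?S \<le> _ * ?I")
proof -
  let ?D = "dilation_ratio TYPE('n)" and ?L = "level_const TYPE('n)" and ?\<kappa> = "jn_rate TYPE('n)"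
  let ?p = "pos_part b" and ?J = "\<integral>\<^sup>+y. ennreal \<bar>f y\<bar> \<partial>lebesgue"
  have \<beta>: "\<beta> > 0" using p by (auto simp: bmo_bounded_def)
  have D: "?D \<ge> 1" and L: "?L \<ge> 0" and \<kappa>: "?\<kappa> > 0"
    using dilation_ratio_ge_1 level_const_nonneg jn_rate_pos by auto
  have pm [measurable]: "?p \<in> borel_measurable lebesgue" unfolding pos_part_def[abs_def] by measurable
  obtain N where N: "N \<in> null_sets lebesgue" "\<And>x. x \<notin> N \<Longrightarrow> neg_part b x \<le> \<beta>"
    using neg by (auto elim!: AE_E3)
  define A where "A = {x. \<exists>Q\<in>cubes. x \<in> Q \<and> ennreal (l / (6 * \<beta>)) * emeasure lebesgue Q \<le> (\<integral>\<^sup>+y\<in>Q. ennreal \<bar>f y\<bar> \<partial>lebesgue)}"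
  define S1 where "S1 = {x. \<exists>Q\<in>cubes. x \<in> Q \<and> ennreal (l / 4) * emeasure lebesgue Q
      < ennreal \<bar>?p x - average ?p Q\<bar> * (\<integral>\<^sup>+y\<in>Q. ennreal \<bar>f y\<bar> \<partial>lebesgue)}"
  define S2 where "S2 = {x. \<exists>Q\<in>cubes. x \<in> Q \<and> ennreal (l / 4) * emeasure lebesgue Q
      \<le> (\<integral>\<^sup>+y\<in>Q. ennreal (\<bar>?p y - average ?p Q\<bar> * \<bar>f y\<bar>) \<partial>lebesgue)}"
  have "?S \<subseteq> (N \<union> A) \<union> (S1 \<union> S2)"
  proof (rule subsetI, rule ccontr)
    fix x assume xS: "x \<in> ?S" and "x \<notin> (N \<union> A) \<union> (S1 \<union> S2)"
    then have x: "x \<notin> N" "x \<notin> A" "x \<notin> S1" "x \<notin> S2" by auto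
    have "\<bar>hl_commutator b f x\<bar> \<le> ereal l"
    proof (rule abs_hl_commutator_le[OF b f neg N(2)[OF x(1)] \<beta> l])
      show "hl_maximal f x \<le> ennreal (l / (6 * \<beta>))"
        unfolding hl_maximal_le_iff using x(2) by (auto simp: A_def not_le intro: less_imp_le)
      show "hl_maximal (\<lambda>y. (?p x - ?p y) * f y) x \<le> ennreal (l / 2)"
        unfolding hl_maximal_le_iff
      proof (intro ballI impI)
        fix Q :: "(real ^ 'n) set"
        assume Q: "Q \<in> cubes" "x \<in> Q"
        then have [measurable]: "Q \<in> sets lebesgue" by (auto simp: cubes_iff)
        let ?q = "average ?p Q"
        have "(\<integral>\<^sup>+y\<in>Q. ennreal \<bar>(?p x - ?p y) * f y\<bar> \<partial>lebesgue)
          \<le> (\<integral>\<^sup>+y. ennreal \<bar>?p x - ?q\<bar> * (ennreal \<bar>f y\<bar> * indicator Q y) + ennreal (\<bar>?p y - ?q\<bar> * \<bar>f y\<bar>) * indicator Q y \<partial>lebesgue)"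
        proof (intro nn_integral_mono)
          fix y
          have "\<bar>?p x - ?p y\<bar> \<le> \<bar>?p x - ?q\<bar> + \<bar>?p y - ?q\<bar>" by linarith
          from mult_right_mono[OF this abs_ge_zero[of "f y"]]
          have "ennreal \<bar>(?p x - ?p y) * f y\<bar> \<le> ennreal (\<bar>?p x - ?q\<bar> * \<bar>f y\<bar> + \<bar>?p y - ?q\<bar> * \<bar>f y\<bar>)"
            by (intro ennreal_leI) (simp add: abs_mult distrib_right)
          also have "\<dots> = ennreal \<bar>?p x - ?q\<bar> * ennreal \<bar>f y\<bar> + ennreal (\<bar>?p y - ?q\<bar> * \<bar>f y\<bar>)"
            by (simp add: ennreal_plus ennreal_mult)
          finally show "ennreal \<bar>(?p x - ?p y) * f y\<bar> * indicator Q y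
            \<le> ennreal \<bar>?p x - ?q\<bar> * (ennreal \<bar>f y\<bar> * indicator Q y) + ennreal (\<bar>?p y - ?q\<bar> * \<bar>f y\<bar>) * indicator Q y"
            by (auto simp: indicator_def)
        qed
        also have "\<dots> = ennreal \<bar>?p x - ?q\<bar> * (\<integral>\<^sup>+y\<in>Q. ennreal \<bar>f y\<bar> \<partial>lebesgue) + (\<integral>\<^sup>+y\<in>Q. ennreal (\<bar>?p y - ?q\<bar> * \<bar>f y\<bar>) \<partial>lebesgue)"
          by (simp add: nn_integral_add nn_integral_cmult)
        also have "\<dots> \<le> ennreal (l / 4) * emeasure lebesgue Q + ennreal (l / 4) * emeasure lebesgue Q"
          using x(3,4) Q by (intro add_mono) (auto simp: S1_def S2_def not_le not_less intro: less_imp_le)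
        also have "\<dots> = (ennreal (l / 4) + ennreal (l / 4)) * emeasure lebesgue Q" by (simp only: distrib_right)
        also have "ennreal (l / 4) + ennreal (l / 4) = ennreal (l / 2)"
          using l by (subst ennreal_plus[symmetric]) auto
        finally show "(\<integral>\<^sup>+y\<in>Q. ennreal \<bar>(?p x - ?p y) * f y\<bar> \<partial>lebesgue) \<le> ennreal (l / 2) * emeasure lebesgue Q" .
      qed
    qed
    then show False using xS by auto
  qed
  then have "outer_measure_of lebesgue ?S \<le> outer_measure_of lebesgue ((N \<union> A) \<union> (S1 \<union> S2))"
    by (rule outer_measure_of_mono)
  also have "\<dots> \<le> outer_measure_of lebesgue (N \<union> A) + outer_measure_of lebesgue (S1 \<union> S2)"
    by (intro outer_measure_of_Un_le) auto
  also have "\<dots> \<le> (outer_measure_of lebesgue N + outer_measure_of lebesgue A) + (outer_measure_of lebesgue S1 + outer_measure_of lebesgue S2)"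
    by (intro add_mono outer_measure_of_Un_le) auto
  also have "outer_measure_of lebesgue N = 0" using N(1) by (simp add: null_setsD1 null_setsD2)
  finally have split: "outer_measure_of lebesgue ?S \<le> outer_measure_of lebesgue A + (outer_measure_of lebesgue S1 + outer_measure_of lebesgue S2)"
    by simp
  have JI: "?J \<le> ennreal l * ?I"
  proof -
    have "?J \<le> (\<integral>\<^sup>+y. ennreal l * ennreal (LlogL_young (\<bar>f y\<bar> / l)) \<partial>lebesgue)"
    proof (intro nn_integral_mono)
      fix y
      have "l * (\<bar>f y\<bar> / l) \<le> l * LlogL_young (\<bar>f y\<bar> / l)"
        using l by (intro mult_left_mono LlogL_young_ge) auto
      then show "ennreal \<bar>f y\<bar> \<le> ennreal l * ennreal (LlogL_young (\<bar>f y\<bar> / l))"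
        using l by (simp add: ennreal_mult'[symmetric] ennreal_leI)
    qed
    also have "\<dots> = ennreal l * ?I" by (intro nn_integral_cmult) measurable
    finally show ?thesis .
  qed
  have \<beta>Y: "\<beta> \<le> LlogL_young \<beta>" and Y: "LlogL_young \<beta> \<ge> 0"
    using \<beta> by (auto intro: LlogL_young_ge LlogL_young_nonneg)
  \<comment> \<open>\<open>A\<close> and \<open>S1\<close> obey bounds linear in \<beta> / l times
    the L1 norm; they are weakened here to the common form needed for \<open>S2\<close>.\<close>
  have scale: "ennreal (k * \<beta> / l) * ?J \<le> ennreal (k * LlogL_young \<beta>) * ?I" if k: "k \<ge> 0" for k
  proof -
    have "ennreal (k * \<beta> / l) * ?J \<le> ennreal (k * \<beta> / l) * (ennreal l * ?I)" by (intro mult_left_mono JI) simp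
    also have "\<dots> = ennreal (k * \<beta>) * ?I"
      using l k \<beta> by (simp add: mult.assoc[symmetric] ennreal_mult'[symmetric])
    also have "\<dots> \<le> ennreal (k * LlogL_young \<beta>) * ?I"
      using k \<beta>Y by (intro mult_right_mono ennreal_leI mult_left_mono) auto
    finally show ?thesis .
  qed
  have "outer_measure_of lebesgue A = ennreal (6 * \<beta> / l) * (ennreal (l / (6 * \<beta>)) * outer_measure_of lebesgue A)"
    using \<beta> l by (simp add: mult.assoc[symmetric] ennreal_mult[symmetric])
  also have "\<dots> \<le> ennreal (6 * \<beta> / l) * (ennreal ?D * ?J)"
    unfolding A_def using \<beta> l by (intro mult_left_mono maximal_weak_type) auto
  also have "\<dots> = ennreal (6 * \<beta> / l * ?D) * ?J"
    unfolding mult.assoc[symmetric] using \<beta> l by (subst ennreal_mult) auto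
  also have "6 * \<beta> / l * ?D = (6 * ?D) * \<beta> / l" by simp
  also have "ennreal ((6 * ?D) * \<beta> / l) * ?J \<le> ennreal ((6 * ?D) * LlogL_young \<beta>) * ?I"
    using D by (intro scale) auto
  finally have 1: "outer_measure_of lebesgue A \<le> ennreal ((6 * ?D) * LlogL_young \<beta>) * ?I" .
  have "outer_measure_of lebesgue S1 \<le> ennreal ((?D + 4 * ?L) * (\<beta> / (l / 4))) * ?J"
    unfolding S1_def using l fin by (intro weak_type_osc_times_average p) auto
  also have "(?D + 4 * ?L) * (\<beta> / (l / 4)) = (4 * (?D + 4 * ?L)) * \<beta> / l" by simp
  also have "ennreal ((4 * (?D + 4 * ?L)) * \<beta> / l) * ?J \<le> ennreal ((4 * (?D + 4 * ?L)) * LlogL_young \<beta>) * ?I"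
    using D L by (intro scale) auto
  finally have 2: "outer_measure_of lebesgue S1 \<le> ennreal ((4 * (?D + 4 * ?L)) * LlogL_young \<beta>) * ?I" .
  let ?t = "\<lambda>y. \<beta> * \<bar>f y\<bar> / (?\<kappa> * (l / 4))" and ?Y = "LlogL_young (4 / ?\<kappa>)"
  have Yk: "?Y \<ge> 0" using \<kappa> by (intro LlogL_young_nonneg) auto
  have "outer_measure_of lebesgue S2 \<le> ennreal (2 * ?D) * (\<integral>\<^sup>+y. ennreal (?t y * max (ln (?t y)) 0) \<partial>lebesgue)"
    unfolding S2_def using l by (intro weak_type_average_of_osc p f) auto
  also have "\<dots> \<le> ennreal (2 * ?D) * (\<integral>\<^sup>+y. ennreal (?Y * LlogL_young \<beta>) * ennreal (LlogL_young (\<bar>f y\<bar> / l)) \<partial>lebesgue)"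
  proof (intro mult_left_mono nn_integral_mono)
    fix y
    \<comment> \<open>In this factorisation submultiplicativity is applied twice, once to split off
      4 / \<open>jn_rate\<close> and once to split off \<beta>.\<close>
    have t: "?t y = 4 / ?\<kappa> * (\<beta> * (\<bar>f y\<bar> / l))" by simp
    have t0: "?t y \<ge> 0" using \<beta> \<kappa> l by simp
    have "?t y * max (ln (?t y)) 0 \<le> LlogL_young (?t y)"
      using t0 by (simp only: LlogL_young_def lnp_def[symmetric] distrib_left)
    also have "\<dots> \<le> ?Y * LlogL_young (\<beta> * (\<bar>f y\<bar> / l))"
      unfolding t using \<kappa> \<beta> l by (intro LlogL_young_mult_le) auto
    also have "\<dots> \<le> ?Y * (LlogL_young \<beta> * LlogL_young (\<bar>f y\<bar> / l))"
      using \<beta> l by (intro mult_left_mono LlogL_young_mult_le Yk) auto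
    finally have "?t y * max (ln (?t y)) 0 \<le> (?Y * LlogL_young \<beta>) * LlogL_young (\<bar>f y\<bar> / l)"
      by (simp only: mult.assoc)
    then show "ennreal (?t y * max (ln (?t y)) 0) \<le> ennreal (?Y * LlogL_young \<beta>) * ennreal (LlogL_young (\<bar>f y\<bar> / l))"
      using Yk Y l by (subst ennreal_mult[symmetric]) (auto intro: ennreal_leI LlogL_young_nonneg)
  qed simp
  also have "\<dots> = ennreal (2 * ?D) * (ennreal (?Y * LlogL_young \<beta>) * ?I)"
    by (subst nn_integral_cmult) auto
  also have "\<dots> = ennreal ((2 * ?D) * (?Y * LlogL_young \<beta>)) * ?I"
    unfolding mult.assoc[of "ennreal _" "ennreal _", symmetric] using D Yk Y by (subst ennreal_mult) auto
  also have "(2 * ?D) * (?Y * LlogL_young \<beta>) = (2 * ?D * ?Y) * LlogL_young \<beta>" by (simp only: mult.assoc)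
  finally have 3: "outer_measure_of lebesgue S2 \<le> ennreal ((2 * ?D * ?Y) * LlogL_young \<beta>) * ?I" .
  have comb: "ennreal (u * z) * w + (ennreal (u' * z) * w + ennreal (u'' * z) * w) = ennreal ((u + u' + u'') * z) * w"
    if "u \<ge> 0" "u' \<ge> 0" "u'' \<ge> 0" "z \<ge> 0" for u u' u'' z :: real and w
    using that by (simp add: distrib_right[symmetric] ennreal_plus[symmetric] add.assoc del: ennreal_plus)
  have "outer_measure_of lebesgue ?S \<le> ennreal ((6 * ?D) * LlogL_young \<beta>) * ?I
      + (ennreal ((4 * (?D + 4 * ?L)) * LlogL_young \<beta>) * ?I + ennreal ((2 * ?D * ?Y) * LlogL_young \<beta>) * ?I)"
    using split add_mono[OF 1 add_mono[OF 2 3]] by (rule order_trans)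
  also have "\<dots> = ennreal ((6 * ?D + 4 * (?D + 4 * ?L) + 2 * ?D * ?Y) * LlogL_young \<beta>) * ?I"
    using D L Yk Y by (intro comb) auto
  finally show ?thesis unfolding commutator_const_def .
qed

section \<open>Degenerate values of C0 and the final estimate\<close>

lemma locally_integrable_pos_part:
  assumes "locally_integrable b"
  shows "locally_integrable (pos_part b)"
  unfolding locally_integrable_def
proof (intro allI impI)
  fix K :: "(real ^ 'a) set"
  assume "compact K"
  then have "integrable lebesgue (\<lambda>x. max (indicator K x *\<^sub>R b x) 0)"
    using assms by (auto simp: locally_integrable_def set_integrable_def)
  also have "(\<lambda>x. max (indicator K x *\<^sub>R b x) 0) = (\<lambda>x. indicator K x *\<^sub>R pos_part b x)"
    by (auto simp: fun_eq_iff pos_part_def indicator_def)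
  finally show "set_integrable lebesgue K (pos_part b)" by (simp add: set_integrable_def)
qed

text \<open>Settles C0 = \<infinity> with a vanishing integral on the right: \<infinity> * 0 = 0 in
  \<open>ennreal\<close>, so the level set itself must then be null.\<close>

lemma hl_commutator_AE_zero:
  fixes b f :: "real ^ 'n \<Rightarrow> real"
  assumes "AE y in lebesgue. f y = 0"
  shows "hl_commutator b f x = 0"
proof -
  have max0: "hl_maximal g x = 0" if "AE y in lebesgue. g y = 0" for g :: "real ^ 'n \<Rightarrow> real"
  proof -
    have "(\<integral>\<^sup>+y\<in>Q. ennreal \<bar>g y\<bar> \<partial>lebesgue) = (\<integral>\<^sup>+y. 0 \<partial>(lebesgue :: (real ^ 'n) measure))" for Q :: "(real ^ 'n) set"
    proof (rule nn_integral_cong_AE)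
      show "AE y in lebesgue. ennreal \<bar>g y\<bar> * indicator Q y = 0"
        using that by eventually_elim simp
    qed
    then have "hl_maximal g x \<le> 0" unfolding hl_maximal_le_iff by simp
    then show ?thesis by simp
  qed
  have "AE y in lebesgue. b y * f y = 0" using assms by (auto elim: eventually_mono)
  then show ?thesis using assms by (simp add: hl_commutator_def max0 zero_ennreal.rep_eq)
qed

theorem theorem6p2:
  shows "\<exists>C::real. C > 0 \<and>
    (\<forall>(b :: real ^ 'n \<Rightarrow> real) (f :: real ^ 'n \<Rightarrow> real) (l::real).
       b \<in> BMO \<longrightarrow> neg_part b \<in> Linf \<longrightarrow> f \<in> LlogL \<longrightarrow> l > 0 \<longrightarrow>
       (let C0 = bmo_norm (pos_part b) + Linf_norm (neg_part b) in
        emeasure lebesgue {x. \<bar>hl_commutator b f x\<bar> > ereal l}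
          \<le> ennreal C * C0 * (1 + log_plus C0) *
            (\<integral>\<^sup>+x. ennreal (\<bar>f x\<bar> / l) * (1 + log_plus (ennreal (\<bar>f x\<bar> / l))) \<partial>lebesgue)))"
proof (intro exI[of _ "commutator_const TYPE('n)"] conjI allI impI)
  let ?C = "commutator_const TYPE('n)"
  show C: "?C > 0" by (rule commutator_const_pos)
  fix b f :: "real ^ 'n \<Rightarrow> real" and l :: real
  assume b: "b \<in> BMO" and neg: "neg_part b \<in> Linf" and f: "f \<in> LlogL" and l: "l > 0"
  let ?S = "{x. \<bar>hl_commutator b f x\<bar> > ereal l}"
  let ?I = "\<integral>\<^sup>+y. ennreal (LlogL_young (\<bar>f y\<bar> / l)) \<partial>lebesgue"
  define C0 where "C0 = bmo_norm (pos_part b) + Linf_norm (neg_part b)"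
  have li: "locally_integrable b" using b by (simp add: BMO_def)
  have bm [measurable]: "b \<in> borel_measurable lebesgue" by (rule locally_integrable_measurable[OF li])
  have fm [measurable]: "f \<in> borel_measurable lebesgue" using f by (simp add: LlogL_def)
  have I: "(\<integral>\<^sup>+x. ennreal (\<bar>f x\<bar> / l) * (1 + log_plus (ennreal (\<bar>f x\<bar> / l))) \<partial>lebesgue) = ?I"
    using l by (intro nn_integral_cong) (simp add: ennreal_LlogL_young)
  have fin: "(\<integral>\<^sup>+y. ennreal (LlogL_young \<bar>f y\<bar>) \<partial>lebesgue) < \<infinity>"
    using f by (simp add: LlogL_def LlogL_integral_def ennreal_LlogL_young)
  \<comment> \<open>Membership in \<open>LlogL\<close> concerns f itself; submultiplicativity with
    the factor 1 / l transfers it to f / l. Finiteness is what lets \<beta> tend to 0 below.\<close>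
  have Ifin: "?I < \<infinity>"
  proof -
    have "?I \<le> (\<integral>\<^sup>+y. ennreal (LlogL_young (1 / l)) * ennreal (LlogL_young \<bar>f y\<bar>) \<partial>lebesgue)"
    proof (intro nn_integral_mono)
      fix y
      have "LlogL_young (1 / l * \<bar>f y\<bar>) \<le> LlogL_young (1 / l) * LlogL_young \<bar>f y\<bar>"
        using l by (intro LlogL_young_mult_le) auto
      then show "ennreal (LlogL_young (\<bar>f y\<bar> / l)) \<le> ennreal (LlogL_young (1 / l)) * ennreal (LlogL_young \<bar>f y\<bar>)"
        using l by (subst ennreal_mult[symmetric]) (auto intro: ennreal_leI LlogL_young_nonneg)
    qed
    also have "\<dots> = ennreal (LlogL_young (1 / l)) * (\<integral>\<^sup>+y. ennreal (LlogL_young \<bar>f y\<bar>) \<partial>lebesgue)"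
      by (intro nn_integral_cmult) measurable
    also have "\<dots> < \<infinity>" using fin by (simp add: ennreal_mult_less_top)
    finally show ?thesis .
  qed
  have "(\<integral>\<^sup>+y. ennreal \<bar>f y\<bar> \<partial>lebesgue) \<le> (\<integral>\<^sup>+y. ennreal (LlogL_young \<bar>f y\<bar>) \<partial>lebesgue)"
    by (intro nn_integral_mono ennreal_leI LlogL_young_ge) simp
  then have fin1: "(\<integral>\<^sup>+y. ennreal \<bar>f y\<bar> \<partial>lebesgue) < \<infinity>" using fin by (rule order.strict_trans1)
  have est: "emeasure lebesgue ?S \<le> ennreal (?C * LlogL_young \<beta>) * ?I" if \<beta>: "\<beta> > 0" "C0 \<le> ennreal \<beta>" for \<beta>
  proof -
    have le: "bmo_norm (pos_part b) \<le> ennreal \<beta>" "Linf_norm (neg_part b) \<le> ennreal \<beta>"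
      using \<beta>(2) unfolding C0_def by (auto intro: order_trans[rotated])
    have "AE y in lebesgue. ennreal \<bar>neg_part b y\<bar> \<le> Linf_norm (neg_part b)"
      unfolding Linf_norm_def by (rule esssup_AE)
    then have "AE y in lebesgue. neg_part b y \<le> \<beta>"
    proof eventually_elim
      case (elim y)
      then have "ennreal \<bar>neg_part b y\<bar> \<le> ennreal \<beta>" using le(2) by (rule order_trans)
      then show ?case using \<beta>(1) by (simp add: ennreal_le_iff)
    qed
    then have "outer_measure_of lebesgue ?S \<le> ennreal (?C * LlogL_young \<beta>) * ?I"
      using bmo_boundedI[OF locally_integrable_pos_part[OF li] \<beta>(1) le(1)] fin1 l
      by (intro hl_commutator_weak_type) auto
    then show ?thesis using emeasure_le_outer_measure_of[of lebesgue ?S] by (rule order_trans[rotated])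
  qed
  have "emeasure lebesgue ?S \<le> ennreal ?C * C0 * (1 + log_plus C0) * ?I"
  proof (cases "C0 = \<infinity>")
    case True
    show ?thesis
    proof (cases "?I = 0")
      case zero: True
      have "AE y in lebesgue. ennreal (LlogL_young (\<bar>f y\<bar> / l)) = 0"
        using zero by (subst (asm) nn_integral_0_iff_AE) auto
      then have "AE y in lebesgue. f y = 0"
      proof eventually_elim
        case (elim y)
        then have "LlogL_young (\<bar>f y\<bar> / l) \<le> 0" by (simp add: ennreal_eq_0_iff)
        then have "\<bar>f y\<bar> / l \<le> 0" using LlogL_young_ge[of "\<bar>f y\<bar> / l"] l by auto
        then show ?case using l by (simp add: field_simps)
      qed
      then show ?thesis using l by (simp add: hl_commutator_AE_zero)
    next
      case False
      then show ?thesis using True C by (simp add: ennreal_mult_top ennreal_top_mult log_plus_def)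
    qed
  next
    case False
    define c where "c = enn2real C0"
    have c: "C0 = ennreal c" "c \<ge> 0" using False by (auto simp: c_def less_top)
    show ?thesis
    proof (cases "c = 0")
      case False
      then have "emeasure lebesgue ?S \<le> ennreal (?C * LlogL_young c) * ?I" using c by (intro est) auto
      also have "ennreal (?C * LlogL_young c) = ennreal ?C * C0 * (1 + log_plus C0)"
        using c C by (simp add: mult.assoc ennreal_LlogL_young ennreal_mult LlogL_young_nonneg)
      finally show ?thesis .
    next
      case True
      obtain i where i: "?I = ennreal i" "i \<ge> 0" using Ifin by (cases ?I) auto
      have "emeasure lebesgue ?S \<le> 0"
      proof (rule ennreal_le_epsilon)
        fix e :: real assume e: "e > 0"
        \<comment> \<open>\<open>C0\<close> is 0 here while \<open>est\<close> demands a positive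
          \<beta>, so \<beta> is taken small. The minimum with 1 makes the logarithm in
          \<open>LlogL_young \<beta>\<close> vanish, and the + 1 keeps the denominator positive even
          if \<open>i\<close> is 0.\<close>
        define \<beta> where "\<beta> = min 1 (e / (?C * i + 1))"
        have Ci: "?C * i \<ge> 0" using C i by simp
        have \<beta>: "\<beta> > 0" "\<beta> \<le> 1" "\<beta> \<le> e / (?C * i + 1)" using e Ci by (auto simp: \<beta>_def)
        have "LlogL_young \<beta> = \<beta>" using \<beta> by (simp add: LlogL_young_def lnp_def)
        then have "emeasure lebesgue ?S \<le> ennreal (?C * \<beta>) * ennreal i"
          using est[of \<beta>] \<beta> c True i by simp
        also have "\<dots> = ennreal ((?C * i) * \<beta>)" using C \<beta> i by (simp add: ennreal_mult[symmetric] mult_ac)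
        also have "(?C * i) * \<beta> \<le> (?C * i + 1) * (e / (?C * i + 1))"
          using Ci \<beta> by (intro mult_mono) auto
        also have "\<dots> = e" using Ci by simp
        finally show "emeasure lebesgue ?S \<le> 0 + ennreal e" by (simp add: ennreal_leI)
      qed
      then show ?thesis by simp
    qed
  qed
  then show "let C0 = bmo_norm (pos_part b) + Linf_norm (neg_part b) in
        emeasure lebesgue ?S \<le> ennreal ?C * C0 * (1 + log_plus C0) *
            (\<integral>\<^sup>+x. ennreal (\<bar>f x\<bar> / l) * (1 + log_plus (ennreal (\<bar>f x\<bar> / l))) \<partial>lebesgue)"
    unfolding Let_def I C0_def .
qed

end
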